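(* Let $W$ and $X$ be $\omega$-Stone spaces. If $\nu(W)=\nu(X)$, $\rho(W)=\rho(X)$, $n(W)=n(X)$ and $(K(W),r_W)\cong(K(X),r_X)$, then $W$ is homeomorphic to $X$. That is, an $\omega$-Stone space $W$ is determined up to homeomorphism by the tuple $[(K(W),r_W),\nu(W),\rho(W),n(W)]$.
   Context: An $\omega$-Stone space is a locally compact metrisable totally disconnected Hausdorff space (equivalently, the Stone space of a countable Boolean ring). For $S\subseteq W$, $S'$ denotes the derived set (set of limit points) of $S$ and $\overline{S}$ its closure. The Cantor–Bendixson sequence is $W^{(0)}=W$, $W^{(\xi+1)}=(W^{(\xi)})'$, $W^{(\eta)}=\bigcap_{\xi<\eta}W^{(\xi)}$ for limit $\eta$; $W^{[\xi]}=W^{(\xi)}-W^{(\xi+1)}$. $\omega_1$ is the set of countable ordinals. Define $\nu(W)=\min\{\xi\mid W^{(\xi)}=W^{(\xi+1)}\}$; $K(W)=W^{(\nu(W))}$ (the perfect kernel); $n(W)=|W^{(\mu)}-K(W)|$ if $\nu(W)=\mu+1$ and $W^{(\mu)}-K(W)$ is finite, and $n(W)=-\infty$ otherwise; the rank function $r_W\colon K(W)\to\omega_1$ is $r_W(x)=\min\{\xi\in\omega_1\mid x\notin\overline{W^{(\xi)}-K(W)}\}$; the compact rank is $\rho(W)=\min\{\xi\mid \overline{W^{[\xi]}}\text{ is compact}\}$. For spaces $U,V$ and maps $r\colon U\to\omega_1$, $s\colon V\to\omega_1$, write $(U,r)\cong(V,s)$ if there is a homeomorphism $\phi\colon U\to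 V$ with $s(\phi(u))=r(u)$ for all $u\in U$. *)

theory Defs
  imports
    "HOL-Analysis.Analysis"
    "HOL-Library.Countable_Set_Type"
    "HOL-Library.Extended_Real"
begin

section \<open>The countable ordinals\<close>

text \<open>The Field of the cardinal successor of \<open>\<aleph>\<^sub>0\<close>, with the well-order
  it carries, is a copy of the first uncountable ordinal: see \<open>countable_lessThan_omega1\<close> and
  \<open>uncountable_omega1\<close>, which characterise it up to order isomorphism.\<close>

lemma Card_order_cardSuc_natLeq: "Card_order (cardSuc natLeq)"
  by (simp add: cardSuc_Card_order natLeq_Card_order)

lemma Well_order_cardSuc_natLeq: "Well_order (cardSuc natLeq)"
  using Card_order_cardSuc_natLeq unfolding card_order_on_def by blast

lemma uncountable_Field_cardSuc_natLeq:
  includes cardinal_syntax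
  shows "\<not> countable (Field (cardSuc natLeq))"
proof
  assume "countable (Field (cardSuc natLeq))"
  then have "|Field (cardSuc natLeq)| \<le>o natLeq"
    by (simp add: countable_card_le_natLeq)
  then have "cardSuc natLeq \<le>o natLeq"
    using card_of_Field_ordIso[OF Card_order_cardSuc_natLeq] ordIso_ordLeq_trans ordIso_symmetric
    by blast
  then show False
    using cardSuc_greater[OF natLeq_Card_order] not_ordLess_ordLeq by blast
qed

typedef omega1 = "Field (cardSuc natLeq)"
  using uncountable_Field_cardSuc_natLeq by (metis countable_empty ex_in_conv)

instantiation omega1 :: wellorder
begin

definition less_eq_omega1 :: "omega1 \<Rightarrow> omega1 \<Rightarrow> bool" where
  "x \<le> y \<longleftrightarrow> (Rep_omega1 x, Rep_omega1 y) \<in> cardSuc natLeq"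

definition less_omega1 :: "omega1 \<Rightarrow> omega1 \<Rightarrow> bool" where
  "x < y \<longleftrightarrow> x \<le> y \<and> \<not> y \<le> (x::omega1)"

instance
proof
  have lin: "Linear_order (cardSuc natLeq)"
    using Well_order_cardSuc_natLeq by (simp add: well_order_on_def)
  then have r: "refl_on (Field (cardSuc natLeq)) (cardSuc natLeq)" and t: "trans (cardSuc natLeq)"
    and a: "antisym (cardSuc natLeq)" and c: "total_on (Field (cardSuc natLeq)) (cardSuc natLeq)"
    by (simp_all add: order_on_defs)
  fix x y z :: omega1
  show "(x < y) = (x \<le> y \<and> \<not> y \<le> x)"
    by (rule less_omega1_def)
  show refl: "x \<le> x"
    unfolding less_eq_omega1_def by (rule refl_onD[OF r Rep_omega1])
  show "x \<le> y \<Longrightarrow> y \<le> z \<Longrightarrow> x \<le> z"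
    unfolding less_eq_omega1_def by (rule transD[OF t])
  show "x \<le> y \<Longrightarrow> y \<le> x \<Longrightarrow> x = y"
    unfolding less_eq_omega1_def Rep_omega1_inject[symmetric] by (rule antisymD[OF a])
  show "x \<le> y \<or> y \<le> x"
  proof (cases "x = y")
    case True
    then show ?thesis
      using refl by simp
  next
    case False
    then have "Rep_omega1 x \<noteq> Rep_omega1 y"
      by (simp add: Rep_omega1_inject)
    then show ?thesis
      using c Rep_omega1[of x] Rep_omega1[of y] by (simp add: less_eq_omega1_def total_on_def)
  qed
next
  fix P :: "omega1 \<Rightarrow> bool" and a
  assume step: "\<And>x. (\<And>y. y < x \<Longrightarrow> P y) \<Longrightarrow> P x"
  have "wf (inv_image (cardSuc natLeq - Id) Rep_omega1)"
    using Well_order_cardSuc_natLeq by (simp add: well_order_on_def)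
  then show "P a"
  proof (induction a rule: wf_induct_rule)
    case (less x)
    show ?case
      by (rule step, rule less.IH)
        (auto simp: less_omega1_def less_eq_omega1_def Rep_omega1_inject)
  qed
qed

end

lemma uncountable_omega1: "\<not> countable (UNIV :: omega1 set)"
proof -
  have "range Rep_omega1 = Field (cardSuc natLeq)"
    using type_definition.Rep_range[OF type_definition_omega1] .
  then show ?thesis
    using uncountable_Field_cardSuc_natLeq countable_image[of UNIV Rep_omega1] by auto
qed

lemma countable_lessThan_omega1:
  includes cardinal_syntax
  fixes \<xi> :: omega1
  shows "countable {..<\<xi>}"
proof -
  let ?U = "underS (cardSuc natLeq) (Rep_omega1 \<xi>)"
  have "|?U| <o cardSuc natLeq"
    using card_of_underS[OF Card_order_cardSuc_natLeq Rep_omega1] .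
  then have "|?U| \<le>o natLeq"
    using cardSuc_ordLeq_ordLess[OF natLeq_Card_order card_of_Card_order] by blast
  then have "countable ?U"
    by (simp add: countable_card_le_natLeq)
  moreover have "Rep_omega1 ` {..<\<xi>} \<subseteq> ?U"
    by (auto simp: underS_def less_omega1_def less_eq_omega1_def Rep_omega1_inject)
  ultimately have "countable (Rep_omega1 ` {..<\<xi>})"
    using countable_subset by blast
  then show ?thesis
    by (rule countable_image_inj_on) (auto simp: inj_on_def Rep_omega1_inject)
qed

instantiation omega1 :: zero
begin

definition zero_omega1 :: omega1 where
  "0 = (LEAST \<xi>::omega1. True)"

instance ..

end

definition osuc :: "omega1 \<Rightarrow> omega1" where
  "osuc \<xi> = (LEAST \<eta>. \<xi> < \<eta>)"

definition opred :: "omega1 \<Rightarrow> omega1" where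
  "opred \<xi> = (THE \<eta>. osuc \<eta> = \<xi>)"

definition olimit :: "omega1 \<Rightarrow> bool" where
  "olimit \<xi> \<longleftrightarrow> \<xi> \<noteq> 0 \<and> (\<nexists>\<eta>. \<xi> = osuc \<eta>)"

lemma omega1_zero_le [simp]: "(0::omega1) \<le> \<xi>"
  unfolding zero_omega1_def by (simp add: Least_le)

lemma omega1_not_less_zero [simp]: "\<not> \<xi> < (0::omega1)"
  by (simp add: not_less)

lemma omega1_no_top: "\<exists>\<eta>::omega1. \<xi> < \<eta>"
proof (rule ccontr)
  assume "\<nexists>\<eta>. \<xi> < \<eta>"
  then have "\<eta> < \<xi>" if "\<eta> \<noteq> \<xi>" for \<eta>
    using that by (metis linorder_neqE)
  then have *: "UNIV = insert \<xi> {..<\<xi>}"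
    by auto
  have "countable (insert \<xi> {..<\<xi>})"
    using countable_lessThan_omega1[of \<xi>] by simp
  then have "countable (UNIV :: omega1 set)"
    by (subst *)
  then show False
    using uncountable_omega1 by contradiction
qed

lemma less_osuc [simp]: "\<xi> < osuc \<xi>"
  unfolding osuc_def using omega1_no_top by (rule LeastI_ex)

lemma osuc_le_iff: "osuc \<xi> \<le> \<eta> \<longleftrightarrow> \<xi> < \<eta>"
  by (metis Least_le less_le_trans less_osuc osuc_def)

lemma osuc_neq_zero [simp]: "osuc \<xi> \<noteq> 0"
  using less_osuc[of \<xi>] by (metis omega1_not_less_zero)

lemma osuc_inject [simp]: "osuc \<xi> = osuc \<eta> \<longleftrightarrow> \<xi> = \<eta>"
  by (metis less_osuc linorder_cases not_less osuc_le_iff)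

lemma opred_osuc [simp]: "opred (osuc \<xi>) = \<xi>"
  unfolding opred_def by simp

section \<open>The Cantor-Bendixson sequence\<close>

function cb :: "'a topology \<Rightarrow> omega1 \<Rightarrow> 'a set" where
  "cb W \<xi> =
     (if \<xi> = 0 then topspace W
      else if olimit \<xi> then (\<Inter>\<eta>\<in>{..<\<xi>}. cb W \<eta>)
      else W derived_set_of (cb W (opred \<xi>)))"
  by pat_completeness auto
termination
proof (relation "inv_image {(\<eta>, \<xi>). \<eta> < \<xi>} snd")
  show "wf (inv_image {(\<eta>, \<xi>). \<eta> < (\<xi>::omega1)} (snd :: 'a topology \<times> omega1 \<Rightarrow> omega1))"
    by (simp add: wf)
qed (auto simp: olimit_def)

declare cb.simps [simp del]

lemma cb_zero: "cb W 0 = topspace W"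
  by (simp add: cb.simps[of W 0])

lemma cb_osuc: "cb W (osuc \<xi>) = W derived_set_of (cb W \<xi>)"
  by (simp add: cb.simps[of W "osuc \<xi>"] olimit_def)

lemma cb_limit: "olimit \<xi> \<Longrightarrow> cb W \<xi> = (\<Inter>\<eta>\<in>{..<\<xi>}. cb W \<eta>)"
  by (simp add: cb.simps[of W \<xi>] olimit_def)

definition cb_level :: "'a topology \<Rightarrow> omega1 \<Rightarrow> 'a set" where
  "cb_level W \<xi> = cb W \<xi> - cb W (osuc \<xi>)"

section \<open>Omega-Stone spaces and their invariants\<close>

definition totally_disconnected_space :: "'a topology \<Rightarrow> bool" where
  "totally_disconnected_space W \<longleftrightarrow> (\<forall>C. connectedin W C \<longrightarrow> (\<exists>a. C \<subseteq> {a}))"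

text \<open>Second countability has to be required: an uncountable discrete space satisfies all the other
  conditions but is not the Stone space of a countable Boolean ring.\<close>

definition omega_stone_space :: "'a topology \<Rightarrow> bool" where
  "omega_stone_space W \<longleftrightarrow>
     locally_compact_space W \<and> metrizable_space W \<and> second_countable W \<and>
     totally_disconnected_space W \<and> Hausdorff_space W"

text \<open>The minima below range over the countable ordinals only; for second countable spaces they are
  attained there (\<open>cb_nu\<close>, \<open>rank_fun_attained\<close>, \<open>compact_rank_attained\<close>).\<close>

definition nu :: "'a topology \<Rightarrow> omega1" where
  "nu W = (LEAST \<xi>. cb W \<xi> = cb W (osuc \<xi>))"

definition perfect_kernel :: "'a topology \<Rightarrow> 'a set" where
  "perfect_kernel W = cb W (nu W)"

definition top_count :: "'a topology \<Rightarrow> ereal" where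
  "top_count W =
     (if \<exists>\<mu>. nu W = osuc \<mu> \<and> finite (cb W \<mu> - perfect_kernel W)
      then ereal (real (card (cb W (opred (nu W)) - perfect_kernel W)))
      else - \<infinity>)"

lemma top_count_osuc:
  "nu W = osuc \<mu> \<Longrightarrow> finite (cb W \<mu> - perfect_kernel W) \<Longrightarrow>
    top_count W = ereal (real (card (cb W \<mu> - perfect_kernel W)))"
  by (simp add: top_count_def)

text \<open>Only the values on the perfect kernel are meaningful.\<close>

definition rank_fun :: "'a topology \<Rightarrow> 'a \<Rightarrow> omega1" where
  "rank_fun W x = (LEAST \<xi>. x \<notin> W closure_of (cb W \<xi> - perfect_kernel W))"

definition compact_rank :: "'a topology \<Rightarrow> omega1" where
  "compact_rank W = (LEAST \<xi>. compactin W (W closure_of (cb_level W \<xi>)))"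

definition ranked_homeomorphic ::
  "'a topology \<Rightarrow> ('a \<Rightarrow> omega1) \<Rightarrow> 'b topology \<Rightarrow> ('b \<Rightarrow> omega1) \<Rightarrow> bool" where
  "ranked_homeomorphic U r V s \<longleftrightarrow>
     (\<exists>\<phi>. homeomorphic_map U V \<phi> \<and> (\<forall>u\<in>topspace U. s (\<phi> u) = r u))"

section \<open>The minima are attained\<close>

lemma cb_subset_topspace_closed: "cb W \<xi> \<subseteq> topspace W \<and> W derived_set_of (cb W \<xi>) \<subseteq> cb W \<xi>"
proof (induction \<xi> rule: less_induct)
  case (less \<xi>)
  consider "\<xi> = 0" | \<eta> where "\<xi> = osuc \<eta>" | "olimit \<xi>"
    unfolding olimit_def by blast
  then show ?case
  proof cases
    case 1
    then show ?thesis
      by (simp add: cb_zero derived_set_of_subset_topspace)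
  next
    case 2
    then have "W derived_set_of (cb W \<eta>) \<subseteq> cb W \<eta>"
      using less.IH by simp
    then show ?thesis
      by (simp add: 2 cb_osuc derived_set_of_subset_topspace derived_set_of_mono)
  next
    case 3
    have "W derived_set_of (cb W \<xi>) \<subseteq> cb W \<eta>" if "\<eta> < \<xi>" for \<eta>
    proof -
      have "cb W \<xi> \<subseteq> cb W \<eta>"
        using that by (auto simp: cb_limit[OF 3])
      then show ?thesis
        using less.IH[OF that] derived_set_of_mono by blast
    qed
    moreover have "cb W \<xi> \<subseteq> topspace W"
    proof -
      have "0 < \<xi>"
        using 3 unfolding olimit_def by (metis omega1_zero_le order_neq_le_trans)
      then show ?thesis
        using less.IH by (auto simp: cb_limit[OF 3])
    qed
    ultimately show ?thesis
      by (auto simp: cb_limit[OF 3])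
  qed
qed

lemma cb_antimono: "\<eta> \<le> \<xi> \<Longrightarrow> cb W \<xi> \<subseteq> cb W \<eta>"
proof (induction \<xi> rule: less_induct)
  case (less \<xi>)
  show ?case
  proof (cases "\<eta> = \<xi>")
    case False
    then have lt: "\<eta> < \<xi>"
      using less.prems by simp
    then have "\<xi> \<noteq> 0"
      by auto
    then consider \<zeta> where "\<xi> = osuc \<zeta>" | "olimit \<xi>"
      unfolding olimit_def by blast
    then show ?thesis
    proof cases
      case 1
      then have "\<eta> \<le> \<zeta>"
        using lt by (metis not_less osuc_le_iff)
      then have "cb W \<zeta> \<subseteq> cb W \<eta>"
        using less.IH 1 by simp
      then show ?thesis
        using cb_subset_topspace_closed[of W \<zeta>] by (auto simp: 1 cb_osuc)
    next
      case 2
      then show ?thesis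
        using lt by (auto simp: cb_limit)
    qed
  qed simp
qed

lemma cb_stabilizes:
  assumes "second_countable W"
  shows "\<exists>\<xi>. cb W \<xi> = cb W (osuc \<xi>)"
proof (rule ccontr)
  assume neq: "\<nexists>\<xi>. cb W \<xi> = cb W (osuc \<xi>)"
  obtain B where B: "countable B"
    "\<And>U x. openin W U \<Longrightarrow> x \<in> U \<Longrightarrow> \<exists>V\<in>B. x \<in> V \<and> V \<subseteq> U"
    using assms unfolding second_countable_def by metis
  have "\<exists>V\<in>B. \<exists>x. V \<inter> cb W \<xi> = {x} \<and> x \<notin> cb W (osuc \<xi>)" for \<xi>
  proof -
    have "cb W (osuc \<xi>) \<subseteq> cb W \<xi>"
      by (rule cb_antimono) (simp add: less_imp_le)
    then obtain x where x: "x \<in> cb W \<xi>" "x \<notin> cb W (osuc \<xi>)"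
      using neq by blast
    then obtain T where T: "x \<in> T" "openin W T" "\<And>y. y \<noteq> x \<Longrightarrow> y \<in> cb W \<xi> \<Longrightarrow> y \<notin> T"
      using cb_subset_topspace_closed[of W \<xi>] unfolding cb_osuc derived_set_of_def by blast
    obtain V where "V \<in> B" "x \<in> V" "V \<subseteq> T"
      using B(2) T by blast
    moreover from this have "V \<inter> cb W \<xi> = {x}"
      using x T by blast
    ultimately show ?thesis
      using x by blast
  qed
  then obtain V where V: "\<And>\<xi>. V \<xi> \<in> B"
    "\<And>\<xi>. \<exists>x. V \<xi> \<inter> cb W \<xi> = {x} \<and> x \<notin> cb W (osuc \<xi>)"
    by metis
  have ne: "V \<xi> \<noteq> V \<eta>" if "\<xi> < \<eta>" for \<xi> \<eta>
  proof
    assume eq: "V \<xi> = V \<eta>"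
    have "cb W \<eta> \<subseteq> cb W (osuc \<xi>)" "cb W \<eta> \<subseteq> cb W \<xi>"
      using that by (auto intro!: cb_antimono simp: osuc_le_iff less_imp_le)
    moreover obtain x where "V \<xi> \<inter> cb W \<xi> = {x}" "x \<notin> cb W (osuc \<xi>)"
      using V(2) by metis
    moreover obtain y where "V \<eta> \<inter> cb W \<eta> = {y}"
      using V(2) by metis
    then have "y \<in> V \<xi>" "y \<in> cb W \<eta>"
      using eq by auto
    ultimately show False
      by auto
  qed
  have "inj V"
    by (rule injI) (metis ne linorder_cases)
  moreover have "countable (range V)"
    using B(1) V(1) by (meson countable_subset image_subsetI)
  ultimately show False
    using uncountable_omega1 countable_image_inj_on by blast
qed

lemma cb_nu:
  assumes "second_countable W"
  shows "cb W (nu W) = cb W (osuc (nu W))"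
  unfolding nu_def using cb_stabilizes[OF assms] by (rule LeastI_ex)

lemma rank_fun_attained: "x \<notin> W closure_of (cb W (rank_fun W x) - perfect_kernel W)"
  unfolding rank_fun_def by (rule LeastI[where k = "nu W"]) (simp add: perfect_kernel_def)

lemma compact_rank_attained:
  assumes "second_countable W"
  shows "compactin W (W closure_of (cb_level W (compact_rank W)))"
  unfolding compact_rank_def
  by (rule LeastI[where k = "nu W"]) (simp add: cb_level_def cb_nu[OF assms, symmetric])

end

(*
  Write S(xi) for the xi-th derived set minus the perfect kernel K. For a clopen set A let
  lambda(A) be the least xi for which the trace of S(xi) on A is compact. Below lambda(A) the
  traces are infinite; a nonempty compact trace contains a last nonempty one, which is finite. So
  the sizes of the traces are infinite up to some mu >= lambda(A), equal to a finite n at mu, and 0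
  above mu, with n = 0 only if mu = lambda(A).

  Let phi be a rank preserving homeomorphism of the kernels of W and X. Match a clopen A in W with
  a clopen B in X if phi maps the kernel part of A onto that of B, the closures of the S(xi) have
  compact traces on A and B for the same xi, and all traces have the same sizes. Compactness of the
  trace of S(xi) on A amounts to compactness of the trace of its closure together with rank at most
  xi on the kernel part of A, hence matched sets have the same lambda. When a compact open set splits
  A, a compact open set of X with the image kernel part splits B, and moving compact open sets that
  miss the kernel from one part to the other corrects the sizes, because for each part it is enough
  to get one of them right.
  The hypotheses say that W and X match, and a back and forth over countable bases of compact open
  sets turns this into a homeomorphism.
*)
theory Submission imports Defs begin

section \<open>Compact open sets\<close>

definition clopenin :: "'a topology \<Rightarrow> 'a set \<Rightarrow> bool" where
  "clopenin W A \<longleftrightarrow> openin W A \<and> closedin W A"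

definition compact_openin :: "'a topology \<Rightarrow> 'a set \<Rightarrow> bool" where
  "compact_openin W A \<longleftrightarrow> openin W A \<and> compactin W A"

lemma clopenin_Int: "clopenin W A \<Longrightarrow> clopenin W B \<Longrightarrow> clopenin W (A \<inter> B)"
  and clopenin_Diff: "clopenin W A \<Longrightarrow> clopenin W B \<Longrightarrow> clopenin W (A - B)"
  by (auto simp: clopenin_def)

lemma clopenin_topspace [simp]: "clopenin W (topspace W)"
  by (simp add: clopenin_def)

lemma clopenin_subset: "clopenin W A \<Longrightarrow> A \<subseteq> topspace W"
  by (simp add: clopenin_def openin_subset)

lemma compact_openin_empty [simp]: "compact_openin W {}"
  by (simp add: compact_openin_def)

lemma compact_openin_Un:
  "compact_openin W A \<Longrightarrow> compact_openin W B \<Longrightarrow> compact_openin W (A \<union> B)"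
  by (auto simp: compact_openin_def compactin_Un)

lemma compactin_clopenin_Int: "compactin W C \<Longrightarrow> clopenin W A \<Longrightarrow> compactin W (A \<inter> C)"
  by (simp add: clopenin_def closed_Int_compactin)

lemma compact_openin_Int_clopenin:
  "compact_openin W C \<Longrightarrow> clopenin W A \<Longrightarrow> compact_openin W (C \<inter> A)"
  by (auto simp: compact_openin_def clopenin_def compact_Int_closedin)

lemma compact_openin_Diff_clopenin:
  assumes "compact_openin W C" "clopenin W A"
  shows "compact_openin W (C - A)"
proof -
  have "C - A = C \<inter> (topspace W - A)"
    using assms by (auto simp: compact_openin_def dest: openin_subset)
  moreover have "clopenin W (topspace W - A)"
    using assms by (auto simp: clopenin_def)
  ultimately show ?thesis
    using compact_openin_Int_clopenin[OF assms(1)] by simp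
qed

lemma compact_openin_imp_clopenin:
  "Hausdorff_space W \<Longrightarrow> compact_openin W A \<Longrightarrow> clopenin W A"
  by (simp add: clopenin_def compact_openin_def compactin_imp_closedin)

section \<open>Compact open neighbourhoods and bases\<close>

locale omega_stone =
  fixes W :: "'a topology"
  assumes stone: "omega_stone_space W"
begin

lemma Hausdorff: "Hausdorff_space W"
  using stone by (simp add: omega_stone_space_def)

lemma second_countable: "second_countable W"
  using stone by (simp add: omega_stone_space_def)

lemma compact_openin_clopenin: "compact_openin W A \<Longrightarrow> clopenin W A"
  using compact_openin_imp_clopenin[OF Hausdorff] .

text \<open>A singleton is a compact component, hence it is separated by a clopen set from the complement
  of a neighbourhood with compact closure.\<close>

lemma compact_open_nbhd:
  assumes "openin W U" "x \<in> U"
  shows "\<exists>V. compact_openin W V \<and> x \<in> V \<and> V \<subseteq> U"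
proof -
  have lc: "locally_compact_space W" and td: "totally_disconnected_space W"
    using stone by (simp_all add: omega_stone_space_def)
  then have "neighbourhood_base_of (compactin W) W"
    using locally_compact_space_neighbourhood_base Hausdorff by blast
  then obtain T N where TN: "openin W T" "compactin W N" "x \<in> T" "T \<subseteq> N" "N \<subseteq> U"
    using assms unfolding neighbourhood_base_of by meson
  have x: "x \<in> topspace W"
    using TN(1,3) openin_subset by blast
  have "connectedin W (connected_component_of_set W x)"
    by (simp add: connectedin_connected_component_of)
  then obtain a where "connected_component_of_set W x \<subseteq> {a}"
    using td unfolding totally_disconnected_space_def by blast
  moreover have "x \<in> connected_component_of_set W x"
    using x by (simp add: connected_component_of_refl)
  ultimately have "connected_component_of_set W x = {x}"
    by blast
  then have "{x} \<in> connected_components_of W"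
    using connected_component_in_connected_components_of x by metis
  then have "separated_between W {x} (topspace W - T)"
    using x TN(1,3) lc Hausdorff
    by (intro separated_between_compact_connected_component) (auto simp: disjnt_def)
  then obtain V where V: "closedin W V" "openin W V" "{x} \<subseteq> V" "topspace W - T \<subseteq> topspace W - V"
    unfolding separated_between by blast
  have "V \<subseteq> T"
    using V(4) openin_subset[OF V(2)] by blast
  then have "compactin W V"
    using closed_compactin[OF TN(2) _ V(1)] TN(4) by blast
  then show ?thesis
    using V \<open>V \<subseteq> T\<close> TN(4,5) unfolding compact_openin_def by blast
qed

lemma compact_open_between:
  assumes "compactin W T" "openin W U" "T \<subseteq> U"
  shows "\<exists>V. compact_openin W V \<and> T \<subseteq> V \<and> V \<subseteq> U"
proof -
  let ?F = "{V. compact_openin W V \<and> V \<subseteq> U}"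
  have "T \<subseteq> \<Union>?F"
    using compact_open_nbhd[OF assms(2)] assms(3) by blast
  then obtain F where F: "finite F" "F \<subseteq> ?F" "T \<subseteq> \<Union>F"
    using compactinD[OF assms(1), of ?F] by (auto simp: compact_openin_def)
  have "compact_openin W (\<Union>F)"
    using F(1,2) by (induction F) (auto intro: compact_openin_Un)
  then show ?thesis
    using F by blast
qed

text \<open>A compact open set is a finite union of members of any base. So a countable base leaves
  only countably many compact open sets, and these again form a base.\<close>

lemma countable_compact_open_base:
  "\<exists>U :: nat \<Rightarrow> 'a set. (\<forall>n. compact_openin W (U n)) \<and>
     (\<forall>T x. openin W T \<longrightarrow> x \<in> T \<longrightarrow> (\<exists>n. x \<in> U n \<and> U n \<subseteq> T))"
proof -
  obtain B where B: "countable B" "\<And>V. V \<in> B \<Longrightarrow> openin W V"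
    "\<And>T x. openin W T \<Longrightarrow> x \<in> T \<Longrightarrow> \<exists>V\<in>B. x \<in> V \<and> V \<subseteq> T"
    using second_countable unfolding second_countable_def by metis
  define F where "F = {V. compact_openin W V \<and> (\<exists>D. finite D \<and> D \<subseteq> B \<and> V = \<Union>D)}"
  have "countable {D. finite D \<and> D \<subseteq> B}"
    using countable_Collect_finite_subset[OF B(1)] by (simp add: conj_commute)
  then have "countable (Union ` {D. finite D \<and> D \<subseteq> B})"
    by simp
  then have "countable F"
    by (rule countable_subset[rotated]) (auto simp: F_def)
  \<comment> \<open>The range of \<open>from_nat_into F\<close> is \<open>F\<close> only if
    \<open>F\<close> is nonempty.\<close>
  moreover have "{} \<in> F"
    by (auto simp: F_def)
  ultimately have F: "range (from_nat_into F) = F"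
    by (intro range_from_nat_into) auto
  have base: "\<exists>V\<in>F. x \<in> V \<and> V \<subseteq> T" if T: "openin W T" "x \<in> T" for T x
  proof -
    obtain V where V: "compact_openin W V" "x \<in> V" "V \<subseteq> T"
      using compact_open_nbhd[OF T] by blast
    have "V \<subseteq> \<Union>{E\<in>B. E \<subseteq> V}"
      using B(3)[of V] V(1) by (auto simp: compact_openin_def)
    then obtain D where D: "finite D" "D \<subseteq> {E\<in>B. E \<subseteq> V}" "V \<subseteq> \<Union>D"
      using compactinD[of W V "{E\<in>B. E \<subseteq> V}"] V(1) B(2) by (auto simp: compact_openin_def)
    then have "V = \<Union>D"
      by blast
    then have "V \<in> F"
      using D V(1) unfolding F_def by blast
    then show ?thesis
      using V by blast
  qed
  show ?thesis
  proof (intro exI[of _ "from_nat_into F"] conjI allI impI)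
    show "compact_openin W (from_nat_into F n)" for n
      using F by (auto simp: F_def)
    show "\<exists>n. x \<in> from_nat_into F n \<and> from_nat_into F n \<subseteq> T" if "openin W T" "x \<in> T" for T x
      using base[OF that] F by (metis rangeE)
  qed
qed

end

section \<open>The Cantor-Bendixson sequence outside the perfect kernel\<close>

lemma omega1_cases:
  obtains "\<xi> = 0" | \<eta> where "\<xi> = osuc \<eta>" | "olimit \<xi>"
  unfolding olimit_def by blast

lemma less_osuc_iff: "\<eta> < osuc \<xi> \<longleftrightarrow> \<eta> \<le> \<xi>"
  by (meson not_le osuc_le_iff)

lemma cb_subset_topspace: "cb W \<xi> \<subseteq> topspace W"
  by (rule conjunct1[OF cb_subset_topspace_closed])

lemma closedin_cb: "closedin W (cb W \<xi>)"
  using derived_set_subset[THEN iffD1, OF cb_subset_topspace conjunct2[OF cb_subset_topspace_closed]] .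

text \<open>Unlike \<open>cb_level W \<xi>\<close>, this set decreases in \<xi>. It is closed in the
  complement of the kernel, so compactness of a trace passes to later stages.\<close>

definition cb_scattered :: "'a topology \<Rightarrow> omega1 \<Rightarrow> 'a set" where
  "cb_scattered W \<xi> = cb W \<xi> - perfect_kernel W"

lemma cb_scattered_antimono: "\<eta> \<le> \<xi> \<Longrightarrow> cb_scattered W \<xi> \<subseteq> cb_scattered W \<eta>"
  unfolding cb_scattered_def by (rule Diff_mono[OF cb_antimono subset_refl])

lemma cb_scattered_nu: "cb_scattered W (nu W) = {}"
  by (simp add: cb_scattered_def perfect_kernel_def)

lemma cb_scattered_ge_nu: "nu W \<le> \<xi> \<Longrightarrow> cb_scattered W \<xi> = {}"
  using cb_scattered_antimono[of "nu W" \<xi> W] by (simp add: cb_scattered_nu)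

lemma cb_scattered_subset_topspace: "cb_scattered W \<xi> \<subseteq> topspace W"
  unfolding cb_scattered_def by (rule subset_trans[OF Diff_subset cb_subset_topspace])

lemma closedin_perfect_kernel: "closedin W (perfect_kernel W)"
  by (simp add: perfect_kernel_def closedin_cb)

lemma perfect_kernel_subset_topspace: "perfect_kernel W \<subseteq> topspace W"
  by (simp add: perfect_kernel_def cb_subset_topspace)

text \<open>\<open>card\<close> is 0 on infinite sets. Values in \<open>enat\<close> keep these
  apart from the empty set and are additive on disjoint unions.\<close>

definition ecard :: "'a set \<Rightarrow> enat" where
  "ecard A = (if finite A then enat (card A) else \<infinity>)"

lemma ecard_empty [simp]: "ecard {} = 0"
  by (simp add: ecard_def zero_enat_def)

lemma ecard_infinite [simp]: "infinite A \<Longrightarrow> ecard A = \<infinity>"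
  by (simp add: ecard_def)

lemma ecard_eq_infinity_iff: "ecard A = \<infinity> \<longleftrightarrow> infinite A"
  by (simp add: ecard_def)

lemma ecard_eq_0_iff: "ecard A = 0 \<longleftrightarrow> A = {}"
  by (auto simp: ecard_def zero_enat_def)

lemma ecard_Un_disjoint: "A \<inter> B = {} \<Longrightarrow> ecard (A \<union> B) = ecard A + ecard B"
  by (simp add: ecard_def card_Un_disjoint)

section \<open>Traces of the derived sets on an open set\<close>

context omega_stone
begin

text \<open>The kernel equals its own derived set, so no derivation removes any of its
  points.\<close>

lemma perfect_kernel_subset_cb: "perfect_kernel W \<subseteq> cb W \<xi>"
proof (induction \<xi> rule: less_induct)
  case (less \<xi>)
  show ?case
  proof (cases \<xi> rule: omega1_cases)
    case 1
    then show ?thesis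
      by (simp add: cb_zero perfect_kernel_subset_topspace)
  next
    case (2 \<eta>)
    have "perfect_kernel W \<subseteq> W derived_set_of (perfect_kernel W)"
      using cb_nu[OF second_countable] by (simp add: perfect_kernel_def cb_osuc)
    also have "\<dots> \<subseteq> W derived_set_of (cb W \<eta>)"
      using less 2 by (intro derived_set_of_mono) simp
    finally show ?thesis
      by (simp add: 2 cb_osuc)
  next
    case 3
    then show ?thesis
      using less by (auto simp: cb_limit)
  qed
qed

lemma openin_Diff_kernel: "openin W A \<Longrightarrow> openin W (A - perfect_kernel W)"
  by (simp add: openin_diff closedin_perfect_kernel)

text \<open>A point of the later stage is a limit point of stage \<eta>. Off the closed kernel it
  has a neighbourhood in \<open>A\<close> without kernel points, and in a Hausdorff space every
  neighbourhood of a limit point contains infinitely many points of the set.\<close>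

lemma Int_cb_scattered_infinite:
  assumes A: "openin W A" and \<xi>: "A \<inter> cb_scattered W \<xi> \<noteq> {}" and "\<eta> < \<xi>"
  shows "infinite (A \<inter> cb_scattered W \<eta>)"
proof -
  obtain x where x: "x \<in> A" "x \<in> cb W \<xi>" "x \<notin> perfect_kernel W"
    using \<xi> by (auto simp: cb_scattered_def)
  have "cb W \<xi> \<subseteq> cb W (osuc \<eta>)"
    by (rule cb_antimono) (simp add: osuc_le_iff assms(3))
  then have "x \<in> W derived_set_of (cb W \<eta>)"
    using x by (auto simp: cb_osuc)
  then have "infinite (cb W \<eta> \<inter> (A - perfect_kernel W))"
    using x openin_Diff_kernel[OF A] by (simp add: derived_set_of_infinite_openin[OF Hausdorff])
  moreover have "cb W \<eta> \<inter> (A - perfect_kernel W) = A \<inter> cb_scattered W \<eta>"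
    by (auto simp: cb_scattered_def)
  ultimately show ?thesis
    by simp
qed

text \<open>If an open set met \<open>cb_scattered W \<xi>\<close> but not the level, the trace of \<open>cb W \<xi>\<close> on it would be
  dense in itself, hence would survive all further derivations.\<close>

lemma Int_cb_level_nonempty:
  assumes A: "openin W A" and \<xi>: "A \<inter> cb_scattered W \<xi> \<noteq> {}"
  shows "A \<inter> cb_level W \<xi> \<noteq> {}"
proof
  assume emp: "A \<inter> cb_level W \<xi> = {}"
  let ?T = "A \<inter> cb W \<xi>"
  have T: "?T \<subseteq> W derived_set_of ?T"
  proof -
    have "?T \<subseteq> A \<inter> W derived_set_of (cb W \<xi>)"
      using emp by (auto simp: cb_level_def cb_osuc)
    also have "\<dots> \<subseteq> W derived_set_of (A \<inter> cb W \<xi>)"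
      using openin_Int_derived_set_of_subset[OF A] by blast
    finally show ?thesis .
  qed
  have "?T \<subseteq> cb W \<eta>" for \<eta>
  proof (induction \<eta> rule: less_induct)
    case (less \<eta>)
    show ?case
    proof (cases \<eta> rule: omega1_cases)
      case 1
      then show ?thesis
        using cb_subset_topspace[of W \<xi>] by (auto simp: cb_zero)
    next
      case (2 \<zeta>)
      then have "W derived_set_of ?T \<subseteq> cb W \<eta>"
        using less by (simp add: cb_osuc derived_set_of_mono)
      then show ?thesis
        using T by blast
    next
      case 3
      then show ?thesis
        using less by (auto simp: cb_limit)
    qed
  qed
  then have "?T \<subseteq> perfect_kernel W"
    by (simp add: perfect_kernel_def)
  then show False
    using \<xi> by (auto simp: cb_scattered_def)
qed

lemma cb_level_subset_cb_scattered: "cb_level W \<xi> \<subseteq> cb_scattered W \<xi>"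
  using perfect_kernel_subset_cb[of "osuc \<xi>"] by (auto simp: cb_level_def cb_scattered_def)

text \<open>This links \<open>compact_rank\<close>, which is defined by levels, to the traces of
  \<open>cb_scattered\<close>. An open set that meets \<open>cb_scattered W \<xi>\<close> meets the
  level too.\<close>

lemma closure_of_cb_level: "W closure_of (cb_level W \<xi>) = W closure_of (cb_scattered W \<xi>)"
proof
  show "W closure_of (cb_level W \<xi>) \<subseteq> W closure_of (cb_scattered W \<xi>)"
    by (rule closure_of_mono) (rule cb_level_subset_cb_scattered)
  show "W closure_of (cb_scattered W \<xi>) \<subseteq> W closure_of (cb_level W \<xi>)"
    using Int_cb_level_nonempty unfolding in_closure_of subset_iff by blast
qed

text \<open>A finite trace of \<open>cb_scattered\<close> has no successor stage, so it lies in the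
  level. If the level trace were finite and the other infinite, removing the level points would
  leave an open set that meets \<open>cb_scattered W \<xi>\<close> but not the level.\<close>

lemma ecard_Int_cb_level:
  assumes A: "openin W A"
  shows "ecard (A \<inter> cb_level W \<xi>) = ecard (A \<inter> cb_scattered W \<xi>)"
proof (cases "finite (A \<inter> cb_scattered W \<xi>)")
  case True
  then have "A \<inter> cb_scattered W (osuc \<xi>) = {}"
    using Int_cb_scattered_infinite[OF A] less_osuc by blast
  then have "A \<inter> cb_level W \<xi> = A \<inter> cb_scattered W \<xi>"
    using perfect_kernel_subset_cb[of "osuc \<xi>"] by (auto simp: cb_level_def cb_scattered_def)
  then show ?thesis
    by simp
next
  case False
  have "infinite (A \<inter> cb_level W \<xi>)"
  proof
    assume fin: "finite (A \<inter> cb_level W \<xi>)"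
    have "A \<inter> cb_level W \<xi> \<subseteq> topspace W"
      using A openin_subset by blast
    then have "openin W (A - A \<inter> cb_level W \<xi>)"
      using A fin closedin_Hausdorff_finite[OF Hausdorff] by blast
    moreover have "(A - A \<inter> cb_level W \<xi>) \<inter> cb_scattered W \<xi> \<noteq> {}"
    proof
      assume "(A - A \<inter> cb_level W \<xi>) \<inter> cb_scattered W \<xi> = {}"
      then have "A \<inter> cb_scattered W \<xi> \<subseteq> A \<inter> cb_level W \<xi>"
        by blast
      then show False
        using False fin finite_subset by blast
    qed
    ultimately show False
      using Int_cb_level_nonempty by blast
  qed
  then show ?thesis
    using False by simp
qed

text \<open>The points of a level are isolated in \<open>cb W \<xi>\<close>, so a finite set of them is cut out of
  \<open>cb W \<xi>\<close> by a compact open set that avoids the kernel.\<close>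

lemma compact_open_with_ecard:
  assumes A: "openin W A" and n: "enat n \<le> ecard (A \<inter> cb_scattered W \<xi>)"
  shows "\<exists>G. compact_openin W G \<and> G \<subseteq> A - perfect_kernel W \<and> ecard (G \<inter> cb_scattered W \<xi>) = enat n
    \<and> (\<forall>\<eta>>\<xi>. G \<inter> cb_scattered W \<eta> = {})"
proof -
  have "\<exists>F. F \<subseteq> A \<inter> cb_level W \<xi> \<and> finite F \<and> card F = n"
  proof (cases "finite (A \<inter> cb_level W \<xi>)")
    case True
    then have "n \<le> card (A \<inter> cb_level W \<xi>)"
      using n unfolding ecard_Int_cb_level[OF A, symmetric] by (simp add: ecard_def)
    then show ?thesis
      using obtain_subset_with_card_n by (metis True finite_subset)
  next
    case False
    then show ?thesis
      using infinite_arbitrarily_large by blast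
  qed
  then obtain F where F: "F \<subseteq> A \<inter> cb_level W \<xi>" "finite F" "card F = n"
    by blast
  have "\<exists>T. openin W T \<and> T \<inter> cb W \<xi> = {x}" if x: "x \<in> F" for x
  proof -
    have "x \<in> cb W \<xi>" "x \<notin> W derived_set_of (cb W \<xi>)" "x \<in> topspace W"
      using x F(1) cb_subset_topspace[of W \<xi>] by (auto simp: cb_level_def cb_osuc)
    then obtain T where T: "x \<in> T" "openin W T" "\<And>y. y \<noteq> x \<Longrightarrow> y \<in> cb W \<xi> \<Longrightarrow> y \<notin> T"
      unfolding in_derived_set_of by blast
    then show ?thesis
      using \<open>x \<in> cb W \<xi>\<close> by (intro exI[of _ T]) auto
  qed
  then obtain T where T: "\<And>x. x \<in> F \<Longrightarrow> openin W (T x)" "\<And>x. x \<in> F \<Longrightarrow> T x \<inter> cb W \<xi> = {x}"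
    by metis
  \<comment> \<open>Inside this open set \<open>cb W \<xi>\<close> consists of the points of
    \<open>F\<close> alone. Removing the kernel loses none of them, as levels are disjoint from
    it.\<close>
  let ?O = "(A \<inter> (\<Union>x\<in>F. T x)) - perfect_kernel W"
  have "openin W ?O"
    using A T(1) by (intro openin_Diff_kernel) auto
  moreover have F_cb: "F \<subseteq> cb_scattered W \<xi>" "F \<subseteq> topspace W"
    using F(1) cb_level_subset_cb_scattered[of \<xi>] cb_scattered_subset_topspace[of W \<xi>] by blast+
  moreover have "F \<subseteq> ?O"
  proof
    fix x assume x: "x \<in> F"
    then have "x \<in> T x"
      using T(2) by blast
    then show "x \<in> ?O"
      using x F(1) F_cb(1) by (auto simp: cb_scattered_def)
  qed
  ultimately obtain G where G: "compact_openin W G" "F \<subseteq> G" "G \<subseteq> ?O"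
    using compact_open_between[of F ?O] F(2) finite_imp_compactin by meson
  have "G \<inter> cb_scattered W \<xi> = F"
  proof
    show "F \<subseteq> G \<inter> cb_scattered W \<xi>"
      using G(2) F_cb(1) by blast
    show "G \<inter> cb_scattered W \<xi> \<subseteq> F"
    proof
      fix y assume y: "y \<in> G \<inter> cb_scattered W \<xi>"
      then obtain x where "x \<in> F" "y \<in> T x"
        using G(3) by blast
      then show "y \<in> F"
        using y T(2)[of x] by (auto simp: cb_scattered_def)
    qed
  qed
  \<comment> \<open>A nonempty later trace would make the trace at \<xi> infinite, but that is the
    finite set \<open>F\<close>.\<close>
  moreover have "G \<inter> cb_scattered W \<eta> = {}" if "\<xi> < \<eta>" for \<eta>
    using Int_cb_scattered_infinite[OF _ _ that] G(1) F(2) calculation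
    unfolding compact_openin_def by metis
  ultimately show ?thesis
    using F(2,3) G(1,3) by (auto simp: ecard_def)
qed

section \<open>Compact traces\<close>

lemma compactin_Int_cb_scattered_mono:
  assumes "compactin W (A \<inter> cb_scattered W \<xi>)" "\<xi> \<le> \<eta>"
  shows "compactin W (A \<inter> cb_scattered W \<eta>)"
proof -
  have "A \<inter> cb_scattered W \<eta> = cb W \<eta> \<inter> (A \<inter> cb_scattered W \<xi>)"
    using cb_scattered_antimono[OF assms(2), of W] by (auto simp: cb_scattered_def)
  then show ?thesis
    using closed_Int_compactin[OF closedin_cb assms(1)] by simp
qed

text \<open>Consider the first stage \<eta> with empty trace. It is not a limit, because nested
  nonempty closed subsets of a compact set have a common point. So it has a predecessor \<mu>, and
  an infinite trace at \<mu> would accumulate at a point of the trace at \<eta>.\<close>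

lemma compact_scattered_top:
  assumes A: "openin W A" and c: "compactin W (A \<inter> cb_scattered W \<xi>)"
    and ne: "A \<inter> cb_scattered W \<xi> \<noteq> {}"
  shows "\<exists>\<mu>\<ge>\<xi>. finite (A \<inter> cb_scattered W \<mu>) \<and> A \<inter> cb_scattered W \<mu> \<noteq> {}"
proof -
  define \<eta> where "\<eta> = (LEAST \<eta>. A \<inter> cb_scattered W \<eta> = {})"
  have emp: "A \<inter> cb_scattered W \<eta> = {}"
    unfolding \<eta>_def by (rule LeastI[where k = "nu W"]) (simp add: cb_scattered_nu)
  have least: "A \<inter> cb_scattered W \<zeta> \<noteq> {}" if "\<zeta> < \<eta>" for \<zeta>
    using not_less_Least[of \<zeta> "\<lambda>\<eta>. A \<inter> cb_scattered W \<eta> = {}"] that unfolding \<eta>_def by blast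
  have "\<xi> < \<eta>"
    using emp ne cb_scattered_antimono[of \<eta> \<xi> W] by (meson disjoint_iff not_less subsetD)
  show ?thesis
  proof (cases \<eta> rule: omega1_cases)
    case 1
    then show ?thesis
      using \<open>\<xi> < \<eta>\<close> by simp
  next
    case (2 \<mu>)
    then have "\<xi> \<le> \<mu>"
      using \<open>\<xi> < \<eta>\<close> by (simp add: less_osuc_iff)
    have "finite (A \<inter> cb_scattered W \<mu>)"
    proof (rule ccontr)
      assume inf: "infinite (A \<inter> cb_scattered W \<mu>)"
      have "A \<inter> cb_scattered W \<mu> \<subseteq> A \<inter> cb_scattered W \<xi>"
        using cb_scattered_antimono[OF \<open>\<xi> \<le> \<mu>\<close>, of W] by blast
      \<comment> \<open>Compactness of the trace at \<xi> keeps the accumulation point in that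
        trace, hence off the kernel.\<close>
      then obtain x where x: "x \<in> A \<inter> cb_scattered W \<xi>" "x \<in> W derived_set_of (A \<inter> cb_scattered W \<mu>)"
        using compactin_imp_Bolzano_Weierstrass[OF c] inf by blast
      have "W derived_set_of (A \<inter> cb_scattered W \<mu>) \<subseteq> cb W \<eta>"
        unfolding 2 cb_osuc by (rule derived_set_of_mono) (auto simp: cb_scattered_def)
      then show False
        using x emp by (auto simp: cb_scattered_def)
    qed
    then show ?thesis
      using \<open>\<xi> \<le> \<mu>\<close> least[of \<mu>] 2 by auto
  next
    case 3
    let ?T = "A \<inter> cb_scattered W \<xi>"
    have "?T \<inter> \<Inter>(cb W ` {..<\<eta>}) \<noteq> {}"
    proof (rule compactin_fip[THEN iffD1, OF c, THEN conjunct2, rule_format], intro conjI allI ballI impI)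
      show "closedin W C" if "C \<in> cb W ` {..<\<eta>}" for C
        using that closedin_cb by auto
      fix F assume "finite F \<and> F \<subseteq> cb W ` {..<\<eta>}"
      then obtain I where I: "finite I" "I \<subseteq> {..<\<eta>}" "F = cb W ` I"
        by (meson finite_subset_image)
      \<comment> \<open>Including \<xi> covers the empty family and puts the witness into
        \<open>?T\<close> as well.\<close>
      define \<mu> where "\<mu> = Max (insert \<xi> I)"
      have "\<mu> \<in> insert \<xi> I" and \<mu>: "\<And>\<zeta>. \<zeta> \<in> insert \<xi> I \<Longrightarrow> \<zeta> \<le> \<mu>"
        using I(1) Max_in[of "insert \<xi> I"] unfolding \<mu>_def by (blast, intro Max_ge) auto
      then have "\<mu> < \<eta>"
        using I(2) \<open>\<xi> < \<eta>\<close> by auto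
      then obtain x where x: "x \<in> A" "x \<in> cb_scattered W \<mu>"
        using least by blast
      have "x \<in> cb_scattered W \<zeta>" if "\<zeta> \<in> insert \<xi> I" for \<zeta>
        using x cb_scattered_antimono[OF \<mu>[OF that], of W] by blast
      then show "?T \<inter> \<Inter>F \<noteq> {}"
        using x I(3) by (auto simp: cb_scattered_def)
    qed
    then have "A \<inter> cb_scattered W \<eta> \<noteq> {}"
      using cb_limit[OF 3, of W] by (auto simp: cb_scattered_def)
    then show ?thesis
      using emp by contradiction
  qed
qed

end

section \<open>Splitting a clopen set\<close>

definition profile :: "'a topology \<Rightarrow> 'a set \<Rightarrow> omega1 \<Rightarrow> enat" where
  "profile W A \<xi> = ecard (A \<inter> cb_scattered W \<xi>)"

text \<open>For \<open>\<mu> > 0\<close>, \<open>step_profile \<mu> 0\<close> and \<open>step_profile \<mu> n\<close> with \<open>n > 0\<close> are the sizes of the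
  derived sets of the ordinal spaces \<open>\<omega>\<^sup>\<mu>\<close> and \<open>\<omega>\<^sup>\<mu> n + 1\<close>.\<close>

definition step_profile :: "omega1 \<Rightarrow> enat \<Rightarrow> omega1 \<Rightarrow> enat" where
  "step_profile \<mu> n \<xi> = (if \<xi> < \<mu> then \<infinity> else if \<xi> = \<mu> then n else 0)"

text \<open>A minimum exists because the trace at \<open>nu W\<close> is empty, hence
  compact.\<close>

definition compact_index :: "'a topology \<Rightarrow> 'a set \<Rightarrow> omega1" where
  "compact_index W A = (LEAST \<xi>. compactin W (A \<inter> cb_scattered W \<xi>))"

section \<open>Shapes of profiles\<close>

context omega_stone
begin

lemma compactin_Int_cb_scattered_iff:
  "compactin W (A \<inter> cb_scattered W \<xi>) \<longleftrightarrow> compact_index W A \<le> \<xi>"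
proof -
  have "compactin W (A \<inter> cb_scattered W (compact_index W A))"
    unfolding compact_index_def by (rule LeastI[where k = "nu W"]) (simp add: cb_scattered_nu)
  then show ?thesis
    using compactin_Int_cb_scattered_mono[of A "compact_index W A" \<xi>] unfolding compact_index_def
    by (auto intro: Least_le)
qed

lemma profile_below:
  assumes A: "openin W A" and "\<eta> < \<xi>" and "profile W A \<xi> \<noteq> 0"
  shows "profile W A \<eta> = \<infinity>"
  using Int_cb_scattered_infinite[OF A _ assms(2)] assms(3)
  by (simp add: profile_def ecard_eq_0_iff)

lemma profile_above:
  assumes A: "openin W A" and "\<eta> < \<xi>" and "profile W A \<eta> \<noteq> \<infinity>"
  shows "profile W A \<xi> = 0"
  using profile_below[OF A assms(2)] assms(3) by blast

text \<open>Finite sets are compact, so a trace that is not compact is infinite.\<close>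

lemma profile_less_compact_index: "\<xi> < compact_index W A \<Longrightarrow> profile W A \<xi> = \<infinity>"
  using compactin_Int_cb_scattered_iff[of A \<xi>] cb_scattered_subset_topspace[of W \<xi>]
    finite_imp_compactin[of "A \<inter> cb_scattered W \<xi>" W]
  by (auto simp: profile_def ecard_def)

text \<open>One finite value fixes the whole profile. Above \<mu> it forces 0. Below \<mu> a nonzero
  value at \<mu> forces infinite traces; if that value is 0, then \<mu> is the compact index and the
  earlier traces are not compact.\<close>

lemma profile_eq_step:
  assumes A: "openin W A" and \<mu>: "compact_index W A \<le> \<mu>" and n: "profile W A \<mu> = enat n"
    and n0: "n = 0 \<Longrightarrow> \<mu> = compact_index W A"
  shows "profile W A = step_profile \<mu> (enat n)"
proof
  fix \<xi>
  consider "\<xi> < \<mu>" | "\<xi> = \<mu>" | "\<mu> < \<xi>"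
    by (rule linorder_cases)
  then show "profile W A \<xi> = step_profile \<mu> (enat n) \<xi>"
  proof cases
    case 1
    then have "profile W A \<xi> = \<infinity>"
      using profile_less_compact_index[of \<xi> A] profile_below[OF A 1] n n0
      by (cases "n = 0") (auto simp: zero_enat_def)
    then show ?thesis
      using 1 by (simp add: step_profile_def)
  next
    case 3
    then show ?thesis
      using profile_above[OF A 3] n 3 by (auto simp: step_profile_def)
  qed (simp add: step_profile_def n)
qed

lemma profile_is_step:
  assumes A: "openin W A"
  shows "\<exists>\<mu> n. compact_index W A \<le> \<mu> \<and> (n = 0 \<longrightarrow> \<mu> = compact_index W A) \<and>
    profile W A = step_profile \<mu> (enat n)"
proof (cases "A \<inter> cb_scattered W (compact_index W A) = {}")
  case True
  then have "profile W A (compact_index W A) = enat 0"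
    by (simp add: profile_def zero_enat_def)
  then show ?thesis
    using profile_eq_step[OF A order_refl] by blast
next
  case False
  then obtain \<mu> where \<mu>: "compact_index W A \<le> \<mu>" "finite (A \<inter> cb_scattered W \<mu>)"
    "A \<inter> cb_scattered W \<mu> \<noteq> {}"
    using compact_scattered_top[OF A _ False] compactin_Int_cb_scattered_iff by blast
  have p: "profile W A \<mu> = enat (card (A \<inter> cb_scattered W \<mu>))"
    using \<mu>(2) by (simp add: profile_def ecard_def)
  have "card (A \<inter> cb_scattered W \<mu>) \<noteq> 0"
    using \<mu>(2,3) by simp
  then show ?thesis
    using profile_eq_step[OF A \<mu>(1) p] \<mu>(1)
    by (intro exI[of _ \<mu>] exI[of _ "card (A \<inter> cb_scattered W \<mu>)"]) simp
qed

lemma profile_Un_disjoint: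
  "A \<inter> B = {} \<Longrightarrow> profile W (A \<union> B) \<xi> = profile W A \<xi> + profile W B \<xi>"
  unfolding profile_def by (subst ecard_Un_disjoint[symmetric]) (auto simp: Int_Un_distrib2)

lemma profile_Diff: "C \<subseteq> A \<Longrightarrow> profile W A \<xi> = profile W C \<xi> + profile W (A - C) \<xi>"
  using profile_Un_disjoint[of C "A - C" \<xi>] by (simp add: Un_absorb1)

lemma profile_eq_0_iff: "profile W A \<xi> = 0 \<longleftrightarrow> A \<inter> cb_scattered W \<xi> = {}"
  by (simp add: profile_def ecard_eq_0_iff)

lemma profile_cong:
  "A \<inter> cb_scattered W \<xi> = B \<inter> cb_scattered W \<xi> \<Longrightarrow> profile W A \<xi> = profile W B \<xi>"
  by (simp add: profile_def)

text \<open>Adding or subtracting such a \<open>G\<close> moves all points of \<open>A\<close> from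
  stage \<xi> on at once and leaves the kernel trace alone.\<close>

lemma compact_open_cover_scattered:
  assumes A: "openin W A" and \<xi>: "compact_index W A \<le> \<xi>"
  shows "\<exists>G. compact_openin W G \<and> A \<inter> cb_scattered W \<xi> \<subseteq> G \<and> G \<subseteq> A - perfect_kernel W"
  using compact_open_between[of "A \<inter> cb_scattered W \<xi>" "A - perfect_kernel W"]
    compactin_Int_cb_scattered_iff[of A \<xi>] \<xi> openin_Diff_kernel[OF A]
  by (auto simp: cb_scattered_def)

text \<open>For a compact open \<open>D \<subseteq> A\<close> with prescribed trace on the kernel the compact indices of \<open>D\<close>
  and \<open>A - D\<close> are determined, so only one value of each of the two profiles has to be adjusted. Start
  with a \<open>D\<close> whose profile is as small as possible, and add the points required in \<open>D\<close>. If the other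
  profile has the lower top, then move all of its surplus points to \<open>D\<close>, and the required ones back.\<close>

lemma split_profile:
  assumes A: "clopenin W A"
    and D0: "compact_openin W D0" "D0 \<subseteq> A" "D0 \<inter> perfect_kernel W = M"
    and ind: "\<And>D. compact_openin W D \<Longrightarrow> D \<subseteq> A \<Longrightarrow> D \<inter> perfect_kernel W = M \<Longrightarrow>
      compact_index W D = \<kappa> \<and> compact_index W (A - D) = \<iota>"
    and sum: "\<And>\<xi>. profile W A \<xi> = step_profile \<mu> (enat m) \<xi> + step_profile \<nu> (enat n) \<xi>"
    and m: "\<kappa> \<le> \<mu>" "m = 0 \<Longrightarrow> \<mu> = \<kappa>"
    and n: "\<iota> \<le> \<nu>" "n = 0 \<Longrightarrow> \<nu> = \<iota>"
  shows "\<exists>D. compact_openin W D \<and> D \<subseteq> A \<and> D \<inter> perfect_kernel W = M \<and>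
    profile W D = step_profile \<mu> (enat m) \<and> profile W (A - D) = step_profile \<nu> (enat n)"
proof -
  have oA: "openin W A"
    using A by (simp add: clopenin_def)
  have oD: "openin W D" "openin W (A - D)" if "compact_openin W D" for D
    using that A compact_openin_clopenin[OF that] clopenin_Diff[of W A D] by (auto simp: clopenin_def)
  \<comment> \<open>\<open>G\<close> takes all points of \<open>D0\<close> from stage \<kappa> on
    and none of the kernel, so \<open>D0 - G\<close> is the start with the smallest profile.\<close>
  obtain G where G: "compact_openin W G" "D0 \<inter> cb_scattered W \<kappa> \<subseteq> G" "G \<subseteq> D0 - perfect_kernel W"
    using compact_open_cover_scattered[OF oD(1)[OF D0(1)], of \<kappa>] ind[OF D0] by auto
  have "enat m \<le> profile W A \<mu>"
    unfolding sum by (simp add: step_profile_def)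
  then obtain H where H: "compact_openin W H" "H \<subseteq> A - perfect_kernel W" "profile W H \<mu> = enat m"
    using compact_open_with_ecard[OF oA, of m \<mu>] unfolding profile_def by blast
  define D where "D = (D0 - G) \<union> H"
  have D: "compact_openin W D" "D \<subseteq> A" "D \<inter> perfect_kernel W = M"
    using D0 G H unfolding D_def
    by (blast intro: compact_openin_Un compact_openin_Diff_clopenin compact_openin_clopenin)+
  have "cb_scattered W \<mu> \<subseteq> cb_scattered W \<kappa>"
    by (rule cb_scattered_antimono[OF m(1)])
  then have "D \<inter> cb_scattered W \<mu> = H \<inter> cb_scattered W \<mu>"
    using G(2) unfolding D_def by blast
  then have "profile W D \<mu> = enat m"
    using H(3) profile_cong[of D \<mu> H] by simp
  then have pD: "profile W D = step_profile \<mu> (enat m)"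
    using profile_eq_step[OF oD(1)[OF D(1)], of \<mu> m] ind[OF D] m by simp
  \<comment> \<open>From \<mu> on the profile of \<open>D\<close> is finite and can be cancelled
    from the sum. Below \<mu> it is infinite and cancellation says nothing.\<close>
  have pR: "profile W (A - D) \<xi> = step_profile \<nu> (enat n) \<xi>" if "\<mu> \<le> \<xi>" for \<xi>
  proof -
    have "step_profile \<mu> (enat m) \<xi> \<noteq> \<infinity>"
      using that by (auto simp: step_profile_def zero_enat_def)
    moreover have "step_profile \<mu> (enat m) \<xi> + profile W (A - D) \<xi> =
        step_profile \<mu> (enat m) \<xi> + step_profile \<nu> (enat n) \<xi>"
      using profile_Diff[OF D(2), of \<xi>] unfolding sum pD by (rule sym)
    ultimately show ?thesis
      by (auto simp: enat_add_left_cancel)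
  qed
  \<comment> \<open>If \<mu> \<le> \<nu>, cancellation already gives the value of
    \<open>A - D\<close> at \<nu>. Otherwise that value is still uncontrolled.\<close>
  show ?thesis
  proof (cases "\<mu> \<le> \<nu>")
    case True
    then have "profile W (A - D) \<nu> = enat n"
      by (simp add: pR step_profile_def)
    then have "profile W (A - D) = step_profile \<nu> (enat n)"
      using profile_eq_step[OF oD(2)[OF D(1)], of \<nu> n] ind[OF D] n by simp
    then show ?thesis
      using D pD by blast
  next
    case False
    then have "\<nu> < \<mu>"
      by simp
    then have "profile W (A - D) \<mu> = 0"
      by (auto simp: pR step_profile_def)
    then have R\<mu>: "(A - D) \<inter> cb_scattered W \<mu> = {}"
      by (simp add: profile_eq_0_iff)
    obtain G' where G': "compact_openin W G'" "(A - D) \<inter> cb_scattered W \<iota> \<subseteq> G'"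
      "G' \<subseteq> (A - D) - perfect_kernel W"
      using compact_open_cover_scattered[OF oD(2)[OF D(1)], of \<iota>] ind[OF D] by auto
    define E where "E = D \<union> G'"
    have E: "compact_openin W E"
      using D(1) G'(1) unfolding E_def by (rule compact_openin_Un)
    have "profile W D \<nu> = \<infinity>"
      using \<open>\<nu> < \<mu>\<close> by (simp add: pD step_profile_def)
    then have "infinite (D \<inter> cb_scattered W \<nu>)"
      by (simp add: profile_def ecard_eq_infinity_iff)
    moreover have "D \<inter> cb_scattered W \<nu> \<subseteq> E \<inter> cb_scattered W \<nu>"
      unfolding E_def by blast
    ultimately have "infinite (E \<inter> cb_scattered W \<nu>)"
      using finite_subset by blast
    \<comment> \<open>\<open>D\<close> is infinite at stage \<nu>, so \<open>E\<close> can supply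
      the \<open>n\<close> points to hand back. \<open>H'\<close> has no points above \<nu>, so the
      value at \<mu> survives.\<close>
    then obtain H' where H': "compact_openin W H'" "H' \<subseteq> E - perfect_kernel W"
      "profile W H' \<nu> = enat n" "\<forall>\<eta>>\<nu>. H' \<inter> cb_scattered W \<eta> = {}"
      using compact_open_with_ecard[OF oD(1)[OF E], of n \<nu>] unfolding profile_def by auto
    define F where "F = E - H'"
    have F: "compact_openin W F" "F \<subseteq> A" "F \<inter> perfect_kernel W = M"
      using E D H' G' unfolding F_def E_def
      by (blast intro: compact_openin_Diff_clopenin compact_openin_clopenin)+
    have "F \<inter> cb_scattered W \<mu> = D \<inter> cb_scattered W \<mu>"
      using H'(4)[rule_format, OF \<open>\<nu> < \<mu>\<close>] G'(3) R\<mu> unfolding F_def E_def by blast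
    then have "profile W F \<mu> = enat m"
      using \<open>profile W D \<mu> = enat m\<close> profile_cong[of F \<mu> D] by simp
    then have "profile W F = step_profile \<mu> (enat m)"
      using profile_eq_step[OF oD(1)[OF F(1)], of \<mu> m] ind[OF F] m by simp
    moreover have "cb_scattered W \<nu> \<subseteq> cb_scattered W \<iota>"
      by (rule cb_scattered_antimono[OF n(1)])
    then have "(A - F) \<inter> cb_scattered W \<nu> = H' \<inter> cb_scattered W \<nu>"
      using G'(2,3) H'(2) D(2) unfolding F_def E_def by blast
    then have "profile W (A - F) \<nu> = enat n"
      using H'(3) profile_cong[of "A - F" \<nu> H'] by simp
    then have "profile W (A - F) = step_profile \<nu> (enat n)"
      using profile_eq_step[OF oD(2)[OF F(1)], of \<nu> n] ind[OF F] n by simp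
    ultimately show ?thesis
      using F by blast
  qed
qed

end

section \<open>Back and forth\<close>

text \<open>For \<open>I\<close> inside \<open>{..<n}\<close> the nonempty cells are the atoms of
  the algebra generated by the first \<open>n\<close> sets. Members of \<open>I\<close> from
  \<open>n\<close> on have no effect, so statements may range over all \<open>I\<close>.\<close>

definition cell :: "'a topology \<Rightarrow> (nat \<Rightarrow> 'a set) \<Rightarrow> nat set \<Rightarrow> nat \<Rightarrow> 'a set" where
  "cell W C I n = {x \<in> topspace W. \<forall>i<n. x \<in> C i \<longleftrightarrow> i \<in> I}"

lemma cell_0 [simp]: "cell W C I 0 = topspace W"
  by (simp add: cell_def)

lemma cell_Suc:
  "cell W C I (Suc n) = (if n \<in> I then cell W C I n \<inter> C n else cell W C I n - C n)"
  by (auto simp: cell_def less_Suc_eq)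

lemma cell_cong: "(\<And>i. i < n \<Longrightarrow> C i = C' i) \<Longrightarrow> cell W C I n = cell W C' I n"
  by (simp add: cell_def)

lemma cell_restrict: "cell W C (I \<inter> {..<n}) n = cell W C I n"
  by (simp add: cell_def)

lemma cell_disjoint:
  assumes "I \<subseteq> {..<n}" "J \<subseteq> {..<n}" "I \<noteq> J"
  shows "cell W C I n \<inter> cell W C J n = {}"
proof -
  obtain i where "i < n" "(i \<in> I) \<noteq> (i \<in> J)"
    using assms by blast
  then show ?thesis
    unfolding cell_def by blast
qed

section \<open>From matching bases to a homeomorphism\<close>

definition open_base_seq :: "'a topology \<Rightarrow> (nat \<Rightarrow> 'a set) \<Rightarrow> bool" where
  "open_base_seq W C \<longleftrightarrow>
    (\<forall>n. openin W (C n)) \<and> (\<forall>T x. openin W T \<longrightarrow> x \<in> T \<longrightarrow> (\<exists>n. x \<in> C n \<and> C n \<subseteq> T))"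

text \<open>The cells of \<open>D\<close> with the pattern of \<open>x\<close> are clopen and
  nested, and they are nonempty because the cells of \<open>C\<close> with this pattern contain
  \<open>x\<close>. Compactness of \<open>D m\<close> yields a common point.\<close>

lemma cell_point:
  assumes "Hausdorff_space X" and D: "\<And>n. compact_openin X (D n)"
    and x: "x \<in> topspace W" "x \<in> C m"
    and ne: "\<And>I n. cell W C I n = {} \<longleftrightarrow> cell X D I n = {}"
  shows "\<exists>y\<in>topspace X. \<forall>n. x \<in> C n \<longleftrightarrow> y \<in> D n"
proof -
  let ?I = "{n. x \<in> C n}"
  have clo: "clopenin X (cell X D ?I n)" for n
    by (induction n) (auto simp: cell_Suc intro!: clopenin_Int clopenin_Diff
        compact_openin_imp_clopenin[OF assms(1) D])
  let ?F = "\<lambda>n. D m \<inter> cell X D ?I n"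
  have "compact_space (subtopology X (D m))"
    using D by (simp add: compact_openin_def compact_space_subtopology)
  moreover have "closedin (subtopology X (D m)) (?F n)" for n
    using clo[of n] closedin_subtopology_Int_closed[of X "cell X D ?I n" "D m"]
    by (simp add: clopenin_def)
  moreover have "?F n \<noteq> {}" for n
  proof -
    \<comment> \<open>With at least \<open>Suc m\<close> sets the cell decides membership at index
      \<open>m\<close>, so the corresponding cell of \<open>X\<close> lies in
      \<open>D m\<close>.\<close>
    have "x \<in> cell W C ?I (max n (Suc m))"
      using x by (simp add: cell_def)
    then have "cell X D ?I (max n (Suc m)) \<noteq> {}"
      using ne by blast
    then obtain y where "y \<in> cell X D ?I (max n (Suc m))"
      by blast
    then have "y \<in> ?F n"
      using x by (auto simp: cell_def)
    then show ?thesis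
      by blast
  qed
  moreover have "decseq ?F"
    by (auto simp: decseq_def cell_def)
  ultimately have "(\<Inter>n. ?F n) \<noteq> {}"
    by (rule compact_space_imp_nest)
  then obtain y where "\<And>n. y \<in> cell X D ?I n"
    by blast
  then have "y \<in> topspace X" "x \<in> C n \<longleftrightarrow> y \<in> D n" for n
    unfolding cell_def by blast+
  then show ?thesis
    by blast
qed

text \<open>The match makes \<open>C n\<close> the preimage of the basic set
  \<open>D n\<close>.\<close>

lemma open_base_seq_continuous:
  assumes C: "\<And>n. openin W (C n)" and D: "open_base_seq X D"
    and g: "\<And>x. x \<in> topspace W \<Longrightarrow> g x \<in> topspace X"
    and match: "\<And>x n. x \<in> topspace W \<Longrightarrow> x \<in> C n \<longleftrightarrow> g x \<in> D n"
  shows "continuous_map W X g"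
  unfolding continuous_map_def
proof (intro conjI allI impI)
  show "g \<in> topspace W \<rightarrow> topspace X"
    using g by blast
  fix T assume T: "openin X T"
  show "openin W {x \<in> topspace W. g x \<in> T}"
  proof (subst openin_subopen, intro ballI)
    fix x assume x: "x \<in> {x \<in> topspace W. g x \<in> T}"
    then obtain n where n: "g x \<in> D n" "D n \<subseteq> T"
      using D T unfolding open_base_seq_def by blast
    have "C n \<subseteq> {x \<in> topspace W. g x \<in> T}"
      using match n(2) openin_subset[OF C[of n]] by blast
    moreover have "x \<in> C n"
      using match x n(1) by blast
    ultimately show "\<exists>S. openin W S \<and> x \<in> S \<and> S \<subseteq> {x \<in> topspace W. g x \<in> T}"
      using C by blast
  qed
qed

lemma open_base_seq_separates:
  assumes "Hausdorff_space W" "open_base_seq W C" "x \<in> topspace W" "y \<in> topspace W"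
    and "\<And>n. x \<in> C n \<longleftrightarrow> y \<in> C n"
  shows "x = y"
proof (rule ccontr)
  assume "x \<noteq> y"
  then obtain U V where "openin W U" "openin W V" "x \<in> U" "y \<in> V" "disjnt U V"
    using assms(1,3,4) unfolding Hausdorff_space_def by meson
  then show False
    using assms(2,5) unfolding open_base_seq_def disjnt_def by blast
qed

text \<open>A point is identified by the basic sets that contain it. The maps \<open>g\<close> and
  \<open>h\<close> pick the point with the same pattern in the other space, hence they are mutually
  inverse.\<close>

lemma homeomorphic_space_matching_bases:
  assumes W: "Hausdorff_space W" and X: "Hausdorff_space X"
    and C: "\<And>n. compact_openin W (C n)" "open_base_seq W C"
    and D: "\<And>n. compact_openin X (D n)" "open_base_seq X D"
    and ne: "\<And>I n. cell W C I n = {} \<longleftrightarrow> cell X D I n = {}"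
  shows "W homeomorphic_space X"
proof -
  have oC: "\<And>n. openin W (C n)" and oD: "\<And>n. openin X (D n)"
    using C(1) D(1) by (simp_all add: compact_openin_def)
  have "\<exists>y\<in>topspace X. \<forall>n. x \<in> C n \<longleftrightarrow> y \<in> D n" if x: "x \<in> topspace W" for x
  proof -
    obtain m where "x \<in> C m"
      using C(2) x unfolding open_base_seq_def by (meson openin_topspace)
    then show ?thesis
      using cell_point[OF X D(1) x _ ne] by blast
  qed
  then obtain g where g: "\<And>x. x \<in> topspace W \<Longrightarrow> g x \<in> topspace X"
    "\<And>x n. x \<in> topspace W \<Longrightarrow> x \<in> C n \<longleftrightarrow> g x \<in> D n"
    by metis
  have "\<exists>x\<in>topspace W. \<forall>n. y \<in> D n \<longleftrightarrow> x \<in> C n" if y: "y \<in> topspace X" for y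
  proof -
    obtain m where "y \<in> D m"
      using D(2) y unfolding open_base_seq_def by (meson openin_topspace)
    then show ?thesis
      using cell_point[OF W C(1) y _ ne[symmetric]] by blast
  qed
  then obtain h where h: "\<And>y. y \<in> topspace X \<Longrightarrow> h y \<in> topspace W"
    "\<And>y n. y \<in> topspace X \<Longrightarrow> y \<in> D n \<longleftrightarrow> h y \<in> C n"
    by metis
  have "homeomorphic_maps W X g h"
    unfolding homeomorphic_maps_def
  proof (intro conjI ballI)
    show "continuous_map W X g"
      by (rule open_base_seq_continuous[OF oC D(2) g])
    show "continuous_map X W h"
      by (rule open_base_seq_continuous[OF oD C(2) h])
    show "h (g x) = x" if "x \<in> topspace W" for x
      by (rule open_base_seq_separates[OF W C(2)])
        (simp_all add: that g(1) h(1) g(2)[OF that] h(2)[OF g(1)[OF that], symmetric])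
    show "g (h y) = y" if "y \<in> topspace X" for y
      by (rule open_base_seq_separates[OF X D(2)])
        (simp_all add: that g(1) h(1) h(2)[OF that] g(2)[OF h(1)[OF that], symmetric])
  qed
  then show ?thesis
    unfolding homeomorphic_space_def by blast
qed

text \<open>Each cell gets its own answer to \<open>U\<close>. Cells are disjoint, so the union of
  the answers restricts to the right answer on every cell.\<close>

lemma extend_matching_cells:
  assumes E: "\<And>I. E (cell W C I n) (cell X D I n)"
    and fwd: "\<And>A B. E A B \<Longrightarrow> \<exists>V. compact_openin X V \<and> V \<subseteq> B \<and> E (A \<inter> U) V \<and> E (A - U) (B - V)"
  shows "\<exists>V. compact_openin X V \<and>
    (\<forall>I. E (cell W C I n \<inter> U) (cell X D I n \<inter> V) \<and> E (cell W C I n - U) (cell X D I n - V))"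
proof -
  obtain V where V: "\<And>I. compact_openin X (V I)" "\<And>I. V I \<subseteq> cell X D I n"
    "\<And>I. E (cell W C I n \<inter> U) (V I)" "\<And>I. E (cell W C I n - U) (cell X D I n - V I)"
    using fwd[OF E] by metis
  \<comment> \<open>Indices from \<open>Pow {..<n}\<close> keep the union finite, hence compact
    open, and every other index set has the same cell as one of these.\<close>
  let ?V = "\<Union>(V ` Pow {..<n})"
  have "compact_openin X (\<Union>(V ` F))" if "finite F" for F
    using that by (induction F) (auto intro: compact_openin_Un V(1))
  then have "compact_openin X ?V"
    by simp
  moreover have inter: "cell X D J n \<inter> ?V = V J" if J: "J \<subseteq> {..<n}" for J
  proof
    show "V J \<subseteq> cell X D J n \<inter> ?V"
      using J V(2) by blast
    show "cell X D J n \<inter> ?V \<subseteq> V J"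
    proof
      fix y assume "y \<in> cell X D J n \<inter> ?V"
      then obtain I where I: "I \<subseteq> {..<n}" "y \<in> V I" "y \<in> cell X D J n"
        by blast
      then have "I = J"
        using cell_disjoint[OF I(1) J, of X D] V(2)[of I] by blast
      then show "y \<in> V J"
        using I by simp
    qed
  qed
  have "E (cell W C J n \<inter> U) (cell X D J n \<inter> ?V) \<and> E (cell W C J n - U) (cell X D J n - ?V)"
    if J: "J \<subseteq> {..<n}" for J
  proof -
    have "cell X D J n - ?V = cell X D J n - V J"
      using inter[OF J] by blast
    then show ?thesis
      using V(3,4)[of J] inter[OF J] by simp
  qed
  then have "E (cell W C I n \<inter> U) (cell X D I n \<inter> ?V) \<and> E (cell W C I n - U) (cell X D I n - ?V)" for I
    using cell_restrict[of W C I n] cell_restrict[of X D I n] Int_lower2[of I "{..<n}"] by metis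
  ultimately show ?thesis
    by blast
qed

text \<open>Base sets of \<open>W\<close> are answered at even steps and those of \<open>X\<close>
  at odd steps. Corresponding cells stay related by \<open>E\<close> throughout, so they are empty
  simultaneously.\<close>

lemma back_and_forth:
  assumes W: "omega_stone_space W" and X: "omega_stone_space X"
    and top: "E (topspace W) (topspace X)"
    and emp: "\<And>A B. E A B \<Longrightarrow> A = {} \<longleftrightarrow> B = {}"
    and fwd: "\<And>A B U. E A B \<Longrightarrow> compact_openin W U \<Longrightarrow>
      \<exists>V. compact_openin X V \<and> V \<subseteq> B \<and> E (A \<inter> U) V \<and> E (A - U) (B - V)"
    and bwd: "\<And>A B V. E A B \<Longrightarrow> compact_openin X V \<Longrightarrow>
      \<exists>U. compact_openin W U \<and> U \<subseteq> A \<and> E U (B \<inter> V) \<and> E (A - U) (B - V)"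
  shows "W homeomorphic_space X"
proof -
  interpret W: omega_stone W by unfold_locales (rule W)
  interpret X: omega_stone X by unfold_locales (rule X)
  obtain U where U: "\<And>n. compact_openin W (U n)"
    "\<And>T x. openin W T \<Longrightarrow> x \<in> T \<Longrightarrow> \<exists>n::nat. x \<in> U n \<and> U n \<subseteq> T"
    using W.countable_compact_open_base by metis
  obtain V where V: "\<And>n. compact_openin X (V n)"
    "\<And>T x. openin X T \<Longrightarrow> x \<in> T \<Longrightarrow> \<exists>n::nat. x \<in> V n \<and> V n \<subseteq> T"
    using X.countable_compact_open_base by metis
  \<comment> \<open>\<open>P f n r\<close> says that the pair \<open>r\<close> may follow the first
    \<open>n\<close> pairs of \<open>f\<close>. Only values of \<open>f\<close> below
    \<open>n\<close> enter, as dependent choice requires.\<close>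
  define P where "P f n r \<longleftrightarrow> compact_openin W (fst r) \<and> compact_openin X (snd r) \<and>
      (even n \<longrightarrow> fst r = U (n div 2)) \<and> (odd n \<longrightarrow> snd r = V (n div 2)) \<and>
      (\<forall>I. E (cell W (fst \<circ> f) I n \<inter> fst r) (cell X (snd \<circ> f) I n \<inter> snd r) \<and>
           E (cell W (fst \<circ> f) I n - fst r) (cell X (snd \<circ> f) I n - snd r))"
    for f :: "nat \<Rightarrow> 'a set \<times> 'b set" and n r
  have cells: "E (cell W (fst \<circ> f) I n) (cell X (snd \<circ> f) I n)" if "\<And>m. m < n \<Longrightarrow> P f m (f m)" for f n I
  proof (cases n)
    case 0
    then show ?thesis
      by (simp add: top)
  next
    case (Suc m)
    then have "P f m (f m)"
      using that by simp
    then show ?thesis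
      unfolding Suc cell_Suc P_def by simp
  qed
  have "\<exists>f. \<forall>n. P f n (f n)"
  proof (rule dependent_wellorder_choice)
    fix r and f g :: "nat \<Rightarrow> 'a set \<times> 'b set" and n :: nat
    assume eq: "\<And>m. m < n \<Longrightarrow> f m = g m"
    have "cell W (fst \<circ> f) I n = cell W (fst \<circ> g) I n" "cell X (snd \<circ> f) I n = cell X (snd \<circ> g) I n" for I
      by (rule cell_cong; simp add: eq)+
    then show "P f n r = P g n r"
      unfolding P_def by simp
  next
    fix n :: nat and f
    assume "\<And>m. m < n \<Longrightarrow> P f m (f m)"
    then have E: "E (cell W (fst \<circ> f) I n) (cell X (snd \<circ> f) I n)" for I
      by (rule cells)
    show "\<exists>r. P f n r"
    proof (cases "even n")
      case True
      obtain D where "compact_openin X D"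
        "\<forall>I. E (cell W (fst \<circ> f) I n \<inter> U (n div 2)) (cell X (snd \<circ> f) I n \<inter> D) \<and>
             E (cell W (fst \<circ> f) I n - U (n div 2)) (cell X (snd \<circ> f) I n - D)"
        using extend_matching_cells[where E = E, OF E fwd[OF _ U(1)]] by blast
      then have "P f n (U (n div 2), D)"
        using U(1) True by (simp add: P_def)
      then show ?thesis
        by blast
    next
      case False
      \<comment> \<open>The back step is the same extension with the spaces exchanged and
        \<open>E\<close> reversed.\<close>
      obtain C where "compact_openin W C"
        "\<forall>I. E (cell W (fst \<circ> f) I n \<inter> C) (cell X (snd \<circ> f) I n \<inter> V (n div 2)) \<and>
             E (cell W (fst \<circ> f) I n - C) (cell X (snd \<circ> f) I n - V (n div 2))"
        using extend_matching_cells[where E = "\<lambda>B A. E A B", OF E bwd[OF _ V(1)]] by blast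
      then have "P f n (C, V (n div 2))"
        using V(1) False by (simp add: P_def)
      then show ?thesis
        by blast
    qed
  qed
  then obtain f where P: "\<And>n. P f n (f n)"
    by blast
  have C: "compact_openin W ((fst \<circ> f) n)" and D: "compact_openin X ((snd \<circ> f) n)" for n
    using P[of n] by (simp_all add: P_def)
  \<comment> \<open>Every \<open>U n\<close> and every \<open>V n\<close> occurs in its sequence, so
    both sequences are bases.\<close>
  have "(fst \<circ> f) (2 * n) = U n" "(snd \<circ> f) (Suc (2 * n)) = V n" for n
    using P[of "2 * n"] P[of "Suc (2 * n)"] by (simp_all add: P_def)
  then have "open_base_seq W (fst \<circ> f)" "open_base_seq X (snd \<circ> f)"
    using C D U(2) V(2) unfolding open_base_seq_def compact_openin_def by metis+
  then show ?thesis
    by (rule homeomorphic_space_matching_bases[OF W.Hausdorff X.Hausdorff C _ D])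
      (rule emp[OF cells[OF P]])
qed

section \<open>Matching clopen sets of two spaces\<close>

definition rank_homeomorphism :: "'a topology \<Rightarrow> 'b topology \<Rightarrow> ('a \<Rightarrow> 'b) \<Rightarrow> bool" where
  "rank_homeomorphism W X \<phi> \<longleftrightarrow>
     homeomorphic_map (subtopology W (perfect_kernel W)) (subtopology X (perfect_kernel X)) \<phi> \<and>
     (\<forall>x\<in>perfect_kernel W. rank_fun X (\<phi> x) = rank_fun W x)"

text \<open>The last clause records for a part \<open>A\<close> what \<open>compact_rank\<close>
  records for the whole space. Kernel traces and ranks alone do not determine it.\<close>

definition kernel_match ::
  "'a topology \<Rightarrow> 'b topology \<Rightarrow> ('a \<Rightarrow> 'b) \<Rightarrow> 'a set \<Rightarrow> 'b set \<Rightarrow> bool" where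
  "kernel_match W X \<phi> A B \<longleftrightarrow> clopenin W A \<and> clopenin X B \<and>
     \<phi> ` (A \<inter> perfect_kernel W) = B \<inter> perfect_kernel X \<and>
     (\<forall>\<xi>. compactin W (A \<inter> W closure_of cb_scattered W \<xi>) \<longleftrightarrow>
          compactin X (B \<inter> X closure_of cb_scattered X \<xi>))"

definition stone_match ::
  "'a topology \<Rightarrow> 'b topology \<Rightarrow> ('a \<Rightarrow> 'b) \<Rightarrow> 'a set \<Rightarrow> 'b set \<Rightarrow> bool" where
  "stone_match W X \<phi> A B \<longleftrightarrow> kernel_match W X \<phi> A B \<and> profile W A = profile X B"

section \<open>Ranks, closures and the invariants of the whole space\<close>

lemma topspace_subtopology_kernel:
  "topspace (subtopology W (perfect_kernel W)) = perfect_kernel W"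
  using perfect_kernel_subset_topspace[of W] by auto

lemma closure_of_cb_scattered_subset: "W closure_of cb_scattered W \<xi> \<subseteq> cb W \<xi>"
  by (rule closure_of_minimal) (auto simp: cb_scattered_def closedin_cb)

lemma closure_of_cb_scattered_iff_rank:
  "x \<in> W closure_of cb_scattered W \<xi> \<longleftrightarrow> \<xi> < rank_fun W x"
proof
  show "x \<in> W closure_of cb_scattered W \<xi>" if "\<xi> < rank_fun W x"
    using not_less_Least[of \<xi> "\<lambda>\<xi>. x \<notin> W closure_of (cb W \<xi> - perfect_kernel W)"] that
    unfolding rank_fun_def cb_scattered_def by blast
  show "\<xi> < rank_fun W x" if "x \<in> W closure_of cb_scattered W \<xi>"
  proof (rule ccontr)
    assume "\<not> \<xi> < rank_fun W x"
    then have "W closure_of cb_scattered W \<xi> \<subseteq> W closure_of cb_scattered W (rank_fun W x)"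
      by (intro closure_of_mono cb_scattered_antimono) simp
    then show False
      using that rank_fun_attained[of x W] unfolding cb_scattered_def by blast
  qed
qed

context omega_stone
begin

text \<open>A compact trace is closed, so it equals the trace of the closure, which then contains no
  kernel point. Conversely, the closure lies in \<open>cb W \<xi>\<close>, so any point it adds
  belongs to the kernel and has rank above \<xi>.\<close>

lemma compactin_Int_cb_scattered_closure:
  assumes A: "clopenin W A"
  shows "compactin W (A \<inter> cb_scattered W \<xi>) \<longleftrightarrow>
    compactin W (A \<inter> W closure_of cb_scattered W \<xi>) \<and>
    (\<forall>x \<in> A \<inter> perfect_kernel W. rank_fun W x \<le> \<xi>)" (is "?L \<longleftrightarrow> ?R")
proof
  have sub: "cb_scattered W \<xi> \<subseteq> W closure_of cb_scattered W \<xi>"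
    by (rule closure_of_subset) (rule cb_scattered_subset_topspace)
  show ?R if ?L
  proof -
    have "closedin W (A \<inter> cb_scattered W \<xi>)"
      using that by (rule compactin_imp_closedin[OF Hausdorff])
    then have "W closure_of (A \<inter> cb_scattered W \<xi>) = A \<inter> cb_scattered W \<xi>"
      by (simp add: closure_of_closedin)
    moreover have "A \<inter> W closure_of cb_scattered W \<xi> \<subseteq> W closure_of (A \<inter> cb_scattered W \<xi>)"
      using A by (intro openin_Int_closure_of_subset) (simp add: clopenin_def)
    ultimately have eq: "A \<inter> W closure_of cb_scattered W \<xi> = A \<inter> cb_scattered W \<xi>"
      using sub by blast
    have "rank_fun W x \<le> \<xi>" if x: "x \<in> A \<inter> perfect_kernel W" for x
    proof (rule ccontr)
      assume "\<not> rank_fun W x \<le> \<xi>"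
      then have "x \<in> A \<inter> W closure_of cb_scattered W \<xi>"
        using x by (simp add: closure_of_cb_scattered_iff_rank not_le)
      then show False
        using x unfolding eq by (simp add: cb_scattered_def)
    qed
    then show ?R
      using that eq by simp
  qed
  show ?L if ?R
  proof -
    have "A \<inter> W closure_of cb_scattered W \<xi> \<subseteq> A \<inter> cb_scattered W \<xi>"
    proof
      fix x assume x: "x \<in> A \<inter> W closure_of cb_scattered W \<xi>"
      then have "\<not> rank_fun W x \<le> \<xi>"
        by (simp add: closure_of_cb_scattered_iff_rank not_le)
      then have "x \<notin> perfect_kernel W"
        using \<open>?R\<close> x by blast
      then show "x \<in> A \<inter> cb_scattered W \<xi>"
        using x closure_of_cb_scattered_subset[of W \<xi>] by (auto simp: cb_scattered_def)
    qed
    then have "A \<inter> W closure_of cb_scattered W \<xi> = A \<inter> cb_scattered W \<xi>"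
      using sub by blast
    then show ?L
      using \<open>?R\<close> by simp
  qed
qed

text \<open>Removing \<open>C\<close> takes only a compact piece away from the trace of a closed
  set.\<close>

lemma compactin_Diff_closedin:
  assumes A: "clopenin W A" and C: "compact_openin W C" and T: "closedin W T"
  shows "compactin W ((A - C) \<inter> T) \<longleftrightarrow> compactin W (A \<inter> T)"
proof
  have clo: "clopenin W C"
    using C by (rule compact_openin_clopenin)
  show "compactin W (A \<inter> T)" if "compactin W ((A - C) \<inter> T)"
  proof -
    have "compactin W (A \<inter> (T \<inter> C))"
      using A C T by (intro compactin_clopenin_Int closed_Int_compactin) (auto simp: compact_openin_def)
    then have "compactin W ((A - C) \<inter> T \<union> A \<inter> (T \<inter> C))"
      using that by (intro compactin_Un)
    moreover have "(A - C) \<inter> T \<union> A \<inter> (T \<inter> C) = A \<inter> T"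
      by blast
    ultimately show ?thesis
      by simp
  qed
  show "compactin W ((A - C) \<inter> T)" if "compactin W (A \<inter> T)"
  proof -
    have "compactin W ((A - C) \<inter> (A \<inter> T))"
      using that clopenin_Diff[OF A clo] by (rule compactin_clopenin_Int)
    moreover have "(A - C) \<inter> (A \<inter> T) = (A - C) \<inter> T"
      by blast
    ultimately show ?thesis
      by simp
  qed
qed

lemma cb_scattered_below_nu: "\<xi> < nu W \<Longrightarrow> cb_scattered W \<xi> \<noteq> {}"
proof
  assume less: "\<xi> < nu W" and "cb_scattered W \<xi> = {}"
  then have "cb W \<xi> = perfect_kernel W"
    using perfect_kernel_subset_cb[of \<xi>] by (auto simp: cb_scattered_def)
  then have "cb W \<xi> = cb W (osuc \<xi>)"
    using cb_antimono[of \<xi> "osuc \<xi>" W] perfect_kernel_subset_cb[of "osuc \<xi>"]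
    by (auto simp: less_imp_le)
  then have "nu W \<le> \<xi>"
    unfolding nu_def by (rule Least_le)
  then show False
    using less by simp
qed

text \<open>Stages below \<open>nu W\<close> are nonempty and make all earlier ones infinite. Only
  the value at a predecessor of \<open>nu W\<close> is left open by \<open>nu\<close>;
  \<open>top_count\<close> supplies it.\<close>

lemma profile_topspace:
  "profile W (topspace W) \<xi> =
    (if nu W \<le> \<xi> then 0 else if osuc \<xi> < nu W then \<infinity> else ecard (cb_scattered W \<xi>))"
proof -
  have int: "topspace W \<inter> cb_scattered W \<eta> = cb_scattered W \<eta>" for \<eta>
    using cb_scattered_subset_topspace[of W \<eta>] by blast
  have "profile W (topspace W) \<xi> = \<infinity>" if "osuc \<xi> < nu W"
    by (rule profile_below[OF _ less_osuc])
      (simp_all add: profile_eq_0_iff int cb_scattered_below_nu[OF that])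
  then show ?thesis
    by (simp add: profile_def int cb_scattered_ge_nu)
qed

lemma compactin_closure_of_cb_scattered:
  "compactin W (topspace W \<inter> W closure_of cb_scattered W \<xi>) \<longleftrightarrow> compact_rank W \<le> \<xi>"
proof -
  have top: "topspace W \<inter> W closure_of cb_scattered W \<eta> = W closure_of cb_scattered W \<eta>" for \<eta>
    using closure_of_subset_topspace[of W "cb_scattered W \<eta>"] by blast
  show ?thesis
    unfolding top
  proof
    show "compact_rank W \<le> \<xi>" if "compactin W (W closure_of cb_scattered W \<xi>)"
      using that unfolding compact_rank_def closure_of_cb_level by (rule Least_le)
    show "compactin W (W closure_of cb_scattered W \<xi>)" if "compact_rank W \<le> \<xi>"
    proof (rule closed_compactin)
      show "compactin W (W closure_of cb_scattered W (compact_rank W))"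
        using compact_rank_attained[OF second_countable] by (simp add: closure_of_cb_level)
      show "W closure_of cb_scattered W \<xi> \<subseteq> W closure_of cb_scattered W (compact_rank W)"
        by (intro closure_of_mono cb_scattered_antimono that)
    qed simp
  qed
qed

end

lemma top_count_eq_cb_scattered:
  "nu W = osuc \<xi> \<Longrightarrow> top_count W =
    (if finite (cb_scattered W \<xi>) then ereal (real (card (cb_scattered W \<xi>))) else - \<infinity>)"
  by (simp add: top_count_def cb_scattered_def)

section \<open>Matched sets and their splittings\<close>

lemma kernel_match_compact_index:
  assumes W: "omega_stone W" and X: "omega_stone X"
    and \<phi>: "rank_homeomorphism W X \<phi>" and m: "kernel_match W X \<phi> A B"
  shows "compact_index W A = compact_index X B"
proof -
  have AB: "clopenin W A" "clopenin X B" and im: "\<phi> ` (A \<inter> perfect_kernel W) = B \<inter> perfect_kernel X"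
    using m by (simp_all add: kernel_match_def)
  have "(\<forall>y \<in> B \<inter> perfect_kernel X. rank_fun X y \<le> \<xi>) \<longleftrightarrow>
      (\<forall>x \<in> A \<inter> perfect_kernel W. rank_fun W x \<le> \<xi>)" for \<xi>
    unfolding im[symmetric] using \<phi> by (auto simp: rank_homeomorphism_def)
  then have "compactin W (A \<inter> cb_scattered W \<xi>) \<longleftrightarrow> compactin X (B \<inter> cb_scattered X \<xi>)" for \<xi>
    using m unfolding omega_stone.compactin_Int_cb_scattered_closure[OF W AB(1)]
      omega_stone.compactin_Int_cb_scattered_closure[OF X AB(2)] kernel_match_def by blast
  then show ?thesis
    by (simp add: compact_index_def)
qed

text \<open>On the compact sets \<open>C\<close> and \<open>D\<close> all closed traces are compact.
  On the differences compactness is inherited from \<open>A\<close> and \<open>B\<close>, and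
  injectivity of \<phi> gives the kernel parts.\<close>

lemma kernel_match_split:
  assumes W: "omega_stone W" and X: "omega_stone X"
    and \<phi>: "rank_homeomorphism W X \<phi>" and m: "kernel_match W X \<phi> A B"
    and C: "compact_openin W C" "C \<subseteq> A" and D: "compact_openin X D" "D \<subseteq> B"
    and im: "\<phi> ` (C \<inter> perfect_kernel W) = D \<inter> perfect_kernel X"
  shows "kernel_match W X \<phi> C D" "kernel_match W X \<phi> (A - C) (B - D)"
proof -
  have AB: "clopenin W A" "clopenin X B"
    using m by (simp_all add: kernel_match_def)
  have CD: "clopenin W C" "clopenin X D"
    using C(1) D(1) omega_stone.compact_openin_clopenin[OF W] omega_stone.compact_openin_clopenin[OF X]
    by blast+
  have "compactin W (C \<inter> W closure_of T)" "compactin X (D \<inter> X closure_of T')" for T T'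
    using C(1) D(1) by (simp_all add: compact_openin_def compact_Int_closedin)
  then show "kernel_match W X \<phi> C D"
    using CD im by (simp add: kernel_match_def)
  have hom: "homeomorphic_map (subtopology W (perfect_kernel W)) (subtopology X (perfect_kernel X)) \<phi>"
    using \<phi> by (simp add: rank_homeomorphism_def)
  have "inj_on \<phi> (perfect_kernel W)"
    using homeomorphic_imp_injective_map[OF hom] unfolding topspace_subtopology_kernel .
  then have "\<phi> ` (A \<inter> perfect_kernel W - C \<inter> perfect_kernel W) =
      \<phi> ` (A \<inter> perfect_kernel W) - \<phi> ` (C \<inter> perfect_kernel W)"
    using C(2) by (intro inj_on_image_set_diff) auto
  moreover have "(A - C) \<inter> perfect_kernel W = A \<inter> perfect_kernel W - C \<inter> perfect_kernel W"
    "(B - D) \<inter> perfect_kernel X = B \<inter> perfect_kernel X - D \<inter> perfect_kernel X"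
    by blast+
  ultimately have "\<phi> ` ((A - C) \<inter> perfect_kernel W) = (B - D) \<inter> perfect_kernel X"
    using m im by (simp add: kernel_match_def)
  then show "kernel_match W X \<phi> (A - C) (B - D)"
    using m AB CD omega_stone.compactin_Diff_closedin[OF W AB(1) C(1)]
      omega_stone.compactin_Diff_closedin[OF X AB(2) D(1)]
    by (simp add: kernel_match_def clopenin_Diff)
qed

text \<open>The image is compact and is cut out of the kernel of \<open>X\<close> by an open
  \<open>T\<close>. A compact open set between the image and \<open>T \<inter> B\<close> meets the
  kernel in nothing else.\<close>

lemma kernel_match_trace:
  assumes W: "omega_stone W" and X: "omega_stone X"
    and \<phi>: "rank_homeomorphism W X \<phi>" and m: "kernel_match W X \<phi> A B"
    and C: "compact_openin W C" "C \<subseteq> A"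
  shows "\<exists>D. compact_openin X D \<and> D \<subseteq> B \<and> D \<inter> perfect_kernel X = \<phi> ` (C \<inter> perfect_kernel W)"
proof -
  let ?K = "subtopology W (perfect_kernel W)" and ?L = "subtopology X (perfect_kernel X)"
  let ?M = "\<phi> ` (C \<inter> perfect_kernel W)"
  have hom: "homeomorphic_map ?K ?L \<phi>"
    using \<phi> by (simp add: rank_homeomorphism_def)
  have "openin ?K (C \<inter> perfect_kernel W)"
    using C(1) unfolding openin_subtopology compact_openin_def by blast
  then have "openin ?L ?M"
    using homeomorphic_imp_open_map[OF hom] unfolding open_map_def by blast
  then obtain T where T: "openin X T" "?M = T \<inter> perfect_kernel X"
    unfolding openin_subtopology by blast
  have "compactin ?K (C \<inter> perfect_kernel W)"
    using C(1) by (simp add: compactin_subtopology compact_openin_def compact_Int_closedin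
        closedin_perfect_kernel)
  then have "compactin ?L ?M"
    using image_compactin homeomorphic_imp_continuous_map[OF hom] by blast
  then have "compactin X ?M"
    by (simp add: compactin_subtopology)
  moreover have "openin X (T \<inter> B)"
    using T(1) m by (auto simp: kernel_match_def clopenin_def)
  moreover have MB: "?M \<subseteq> B"
    using m C(2) unfolding kernel_match_def by blast
  ultimately obtain D where "compact_openin X D" "?M \<subseteq> D" "D \<subseteq> T \<inter> B"
    using omega_stone.compact_open_between[OF X, of ?M "T \<inter> B"] T(2) by blast
  then show ?thesis
    using T(2) by blast
qed

text \<open>\<open>split_profile\<close> is applied to \<open>B\<close> in \<open>X\<close>. The
  target profiles are those of the two parts of \<open>A\<close>, which add up to the profile of
  \<open>B\<close>.\<close>

lemma stone_match_forth:
  assumes W: "omega_stone W" and X: "omega_stone X"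
    and \<phi>: "rank_homeomorphism W X \<phi>" and m: "stone_match W X \<phi> A B"
    and U: "compact_openin W U"
  shows "\<exists>V. compact_openin X V \<and> V \<subseteq> B \<and> stone_match W X \<phi> (A \<inter> U) V \<and>
    stone_match W X \<phi> (A - U) (B - V)"
proof -
  interpret W: omega_stone W by (rule W)
  interpret X: omega_stone X by (rule X)
  have km: "kernel_match W X \<phi> A B" and prof: "profile W A = profile X B"
    using m by (simp_all add: stone_match_def)
  have A: "clopenin W A" and B: "clopenin X B"
    using km by (simp_all add: kernel_match_def)
  let ?C = "A \<inter> U"
  have C: "compact_openin W ?C" "?C \<subseteq> A"
    using compact_openin_Int_clopenin[OF U A] by (simp_all add: Int_commute)
  have AU: "A - ?C = A - U"
    by blast
  have "clopenin W (A - ?C)"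
    using A W.compact_openin_clopenin[OF C(1)] by (rule clopenin_Diff)
  then have oC: "openin W ?C" "openin W (A - ?C)"
    using C(1) by (simp_all add: clopenin_def compact_openin_def)
  obtain \<mu> p where p: "compact_index W ?C \<le> \<mu>" "p = 0 \<longrightarrow> \<mu> = compact_index W ?C"
    "profile W ?C = step_profile \<mu> (enat p)"
    using W.profile_is_step[OF oC(1)] by metis
  obtain \<nu> q where q: "compact_index W (A - ?C) \<le> \<nu>" "q = 0 \<longrightarrow> \<nu> = compact_index W (A - ?C)"
    "profile W (A - ?C) = step_profile \<nu> (enat q)"
    using W.profile_is_step[OF oC(2)] by metis
  let ?M = "\<phi> ` (?C \<inter> perfect_kernel W)"
  obtain D0 where D0: "compact_openin X D0" "D0 \<subseteq> B" "D0 \<inter> perfect_kernel X = ?M"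
    using kernel_match_trace[OF W X \<phi> km C] by blast
  have "\<exists>D. compact_openin X D \<and> D \<subseteq> B \<and> D \<inter> perfect_kernel X = ?M \<and>
      profile X D = step_profile \<mu> (enat p) \<and> profile X (B - D) = step_profile \<nu> (enat q)"
  proof (rule X.split_profile[OF B D0])
    fix D assume D: "compact_openin X D" "D \<subseteq> B" "D \<inter> perfect_kernel X = ?M"
    \<comment> \<open>Any \<open>D\<close> with the prescribed kernel trace already gives kernel
      matches of both parts, and these determine the compact indices.\<close>
    show "compact_index X D = compact_index W ?C \<and> compact_index X (B - D) = compact_index W (A - ?C)"
      using kernel_match_split[OF W X \<phi> km C D(1,2) D(3)[symmetric]]
      by (simp only: kernel_match_compact_index[OF W X \<phi>])
  next
    show "profile X B \<xi> = step_profile \<mu> (enat p) \<xi> + step_profile \<nu> (enat q) \<xi>" for \<xi>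
      using W.profile_Diff[OF C(2), of \<xi>] unfolding p(3) q(3) prof .
  qed (use p q in auto)
  then obtain D where D: "compact_openin X D" "D \<subseteq> B" "D \<inter> perfect_kernel X = ?M"
    "profile X D = step_profile \<mu> (enat p)" "profile X (B - D) = step_profile \<nu> (enat q)"
    by blast
  then have "stone_match W X \<phi> ?C D" "stone_match W X \<phi> (A - ?C) (B - D)"
    using kernel_match_split[OF W X \<phi> km C D(1,2) D(3)[symmetric]] p(3) q(3)
    by (simp_all add: stone_match_def)
  then show ?thesis
    using D(1,2) unfolding AU by blast
qed

text \<open>By this symmetry the back step follows from the forth step.\<close>

lemma rank_homeomorphism_inverse:
  assumes "rank_homeomorphism W X \<phi>"
  shows "\<exists>\<psi>. rank_homeomorphism X W \<psi> \<and> (\<forall>A B. stone_match X W \<psi> B A \<longleftrightarrow> stone_match W X \<phi> A B)"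
proof -
  let ?K = "perfect_kernel W" and ?L = "perfect_kernel X"
  obtain \<psi> where maps: "homeomorphic_maps (subtopology W ?K) (subtopology X ?L) \<phi> \<psi>"
    using assms homeomorphic_map_maps unfolding rank_homeomorphism_def by blast
  then have \<psi>: "homeomorphic_map (subtopology X ?L) (subtopology W ?K) \<psi>"
    using homeomorphic_maps_sym homeomorphic_maps_map by blast
  have inv: "\<And>x. x \<in> ?K \<Longrightarrow> \<psi> (\<phi> x) = x" "\<And>y. y \<in> ?L \<Longrightarrow> \<phi> (\<psi> y) = y"
    using maps unfolding homeomorphic_maps_def topspace_subtopology_kernel by blast+
  have im: "\<psi> ` ?L = ?K"
    using homeomorphic_imp_surjective_map[OF \<psi>] unfolding topspace_subtopology_kernel .
  then have "rank_fun W (\<psi> y) = rank_fun X y" if "y \<in> ?L" for y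
    using assms inv(2)[OF that] that unfolding rank_homeomorphism_def by (metis imageI)
  then have "rank_homeomorphism X W \<psi>"
    using \<psi> by (simp add: rank_homeomorphism_def)
  moreover have "\<psi> ` (B \<inter> ?L) = A \<inter> ?K \<longleftrightarrow> \<phi> ` (A \<inter> ?K) = B \<inter> ?L" for A B
  proof
    have "\<psi> ` \<phi> ` (A \<inter> ?K) = A \<inter> ?K" "\<phi> ` \<psi> ` (B \<inter> ?L) = B \<inter> ?L"
      using inv by (force simp: image_image)+
    then show "\<psi> ` (B \<inter> ?L) = A \<inter> ?K \<Longrightarrow> \<phi> ` (A \<inter> ?K) = B \<inter> ?L"
      "\<phi> ` (A \<inter> ?K) = B \<inter> ?L \<Longrightarrow> \<psi> ` (B \<inter> ?L) = A \<inter> ?K"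
      by simp_all
  qed
  then have "stone_match X W \<psi> B A \<longleftrightarrow> stone_match W X \<phi> A B" for A B
    unfolding stone_match_def kernel_match_def by auto
  ultimately show ?thesis
    by blast
qed

text \<open>At stage 0 the kernel and the scattered part exhaust the space, and a match compares
  emptiness of both traces.\<close>

lemma stone_match_empty_iff:
  assumes "stone_match W X \<phi> A B"
  shows "A = {} \<longleftrightarrow> B = {}"
proof -
  have "A \<inter> perfect_kernel W = {} \<longleftrightarrow> B \<inter> perfect_kernel X = {}"
    using assms unfolding stone_match_def kernel_match_def by (metis image_is_empty)
  moreover have "A \<inter> cb_scattered W 0 = {} \<longleftrightarrow> B \<inter> cb_scattered X 0 = {}"
    using assms unfolding stone_match_def profile_def by (metis ecard_eq_0_iff)
  moreover have "A \<subseteq> topspace W" "B \<subseteq> topspace X"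
    using assms unfolding stone_match_def kernel_match_def by (auto dest: clopenin_subset)
  ultimately show ?thesis
    unfolding cb_scattered_def cb_zero by blast
qed

lemma stone_match_topspace:
  assumes W: "omega_stone W" and X: "omega_stone X" and \<phi>: "rank_homeomorphism W X \<phi>"
    and nu: "nu W = nu X" and rank: "compact_rank W = compact_rank X"
    and count: "top_count W = top_count X"
  shows "stone_match W X \<phi> (topspace W) (topspace X)"
proof -
  interpret W: omega_stone W by (rule W)
  interpret X: omega_stone X by (rule X)
  have top: "topspace W \<inter> perfect_kernel W = perfect_kernel W"
    "topspace X \<inter> perfect_kernel X = perfect_kernel X"
    using perfect_kernel_subset_topspace[of W] perfect_kernel_subset_topspace[of X] by blast+
  have hom: "homeomorphic_map (subtopology W (perfect_kernel W)) (subtopology X (perfect_kernel X)) \<phi>"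
    using \<phi> by (simp add: rank_homeomorphism_def)
  have "\<phi> ` perfect_kernel W = perfect_kernel X"
    using homeomorphic_imp_surjective_map[OF hom] unfolding topspace_subtopology_kernel .
  then have "kernel_match W X \<phi> (topspace W) (topspace X)"
    by (simp add: kernel_match_def top rank W.compactin_closure_of_cb_scattered
        X.compactin_closure_of_cb_scattered)
  moreover have "profile W (topspace W) \<xi> = profile X (topspace X) \<xi>" for \<xi>
  proof (cases "nu X = osuc \<xi>")
    case True
    \<comment> \<open>In \<open>top_count\<close> the value -\<infinity> marks an infinite last
      stage, so equal values give equal sizes in \<open>enat\<close>.\<close>
    then have "ecard (cb_scattered W \<xi>) = ecard (cb_scattered X \<xi>)"
      using count top_count_eq_cb_scattered[of W \<xi>] top_count_eq_cb_scattered[of X \<xi>] nu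
      by (simp add: ecard_def split: if_splits)
    then show ?thesis
      by (simp add: W.profile_topspace X.profile_topspace nu)
  next
    case False
    then have "nu X \<le> \<xi> \<or> osuc \<xi> < nu X"
      using osuc_le_iff[of \<xi> "nu X"] by (auto simp: order_le_less)
    then show ?thesis
      by (auto simp: W.profile_topspace X.profile_topspace nu)
  qed
  ultimately show ?thesis
    by (simp add: stone_match_def fun_eq_iff)
qed

theorem theorem10:
  fixes W :: "'a topology" and X :: "'b topology"
  assumes "omega_stone_space W" and "omega_stone_space X"
    and "nu W = nu X"
    and "compact_rank W = compact_rank X"
    and "top_count W = top_count X"
    and "ranked_homeomorphic
           (subtopology W (perfect_kernel W)) (rank_fun W)
           (subtopology X (perfect_kernel X)) (rank_fun X)"
  shows "W homeomorphic_space X"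
proof -
  have W: "omega_stone W" and X: "omega_stone X"
    using assms(1,2) by (simp_all add: omega_stone_def)
  obtain \<phi> where \<phi>: "rank_homeomorphism W X \<phi>"
    using assms(6) unfolding ranked_homeomorphic_def rank_homeomorphism_def topspace_subtopology_kernel
    by blast
  obtain \<psi> where \<psi>: "rank_homeomorphism X W \<psi>"
    and sym: "\<And>A B. stone_match X W \<psi> B A \<longleftrightarrow> stone_match W X \<phi> A B"
    using rank_homeomorphism_inverse[OF \<phi>] by blast
  show ?thesis
  proof (rule back_and_forth[OF assms(1,2)])
    show "stone_match W X \<phi> (topspace W) (topspace X)"
      by (rule stone_match_topspace[OF W X \<phi> assms(3-5)])
    show "A = {} \<longleftrightarrow> B = {}" if "stone_match W X \<phi> A B" for A B
      using that by (rule stone_match_empty_iff)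
    show "\<exists>V. compact_openin X V \<and> V \<subseteq> B \<and> stone_match W X \<phi> (A \<inter> U) V \<and>
        stone_match W X \<phi> (A - U) (B - V)"
      if "stone_match W X \<phi> A B" "compact_openin W U" for A B U
      using that by (rule stone_match_forth[OF W X \<phi>])
    show "\<exists>U. compact_openin W U \<and> U \<subseteq> A \<and> stone_match W X \<phi> U (B \<inter> V) \<and>
        stone_match W X \<phi> (A - U) (B - V)"
      if "stone_match W X \<phi> A B" "compact_openin X V" for A B V
      \<comment> \<open>This is the forth step for \<psi>, read backwards through
        \<open>sym\<close>.\<close>
      using stone_match_forth[OF X W \<psi>, of B A V] that by (simp add: sym)
  qed
qed

end
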